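(* Let $d\ge 2$, $\beta\ge 0$, let $\mu$ be an atomless probability distribution on $\mathbb{R}$, and let $\omega=(\omega_e)_{e\in E^d}$ be i.i.d. with law $\mu$ (joint law $\mathbb{P}$, expectation $\mathbb{E}$). Then the limit $$\varrho(\beta):=\lim_{n\to\infty}\frac{\widehat{\mathcal{O}}_{\Lambda_n}(\beta)}{|\Lambda_n|-1},\qquad \widehat{\mathcal{O}}_{\Lambda_n}(\beta):=\sum_{e\in\Lambda_n\cap E^d}\mathbf{P}^{\omega}_{\infty,\beta}(e\in\mathcal{T})^2,$$ exists $\mathbb{P}$-almost surely, and for any edge $e\in E^d$ it is given by $$\varrho(\beta)=d\,\mathbb{E}\big[\mathbf{P}^{\omega}_{\infty,\beta}(e\in\mathcal{T})^2\big].$$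
   Context: $\mathbb{L}^d=(\mathbb{Z}^d,E^d)$ is the nearest-neighbour lattice, $E^d=\{(u,v):\|u-v\|_1=1\}$ (undirected edges), $\Lambda_n=[-n,n]^d\cap\mathbb{Z}^d$, and $\Lambda_n\cap E^d$ denotes the edges with both endpoints in $\Lambda_n$. For given $\omega$, let $\mathbf{P}^{\omega,F}_{\Lambda_n,\beta}$ be the probability measure on spanning trees $T$ of the subgraph of $\mathbb{L}^d$ induced by $\Lambda_n$ proportional to $\prod_{e\in T}e^{-\beta\omega_e}$. For $\mathbb{P}$-a.e. $\omega$ these converge weakly to a probability measure $\mathbf{P}^{\omega}_{\infty,\beta}$ on subgraphs $\mathcal{T}$ of $\mathbb{L}^d$, meaning $\mathbf{P}^{\omega}_{\infty,\beta}(A\subset\mathcal{T})=\lim_n\mathbf{P}^{\omega,F}_{\Lambda_n,\beta}(A\subset\mathcal{T})$ for every finite $A\subset E^d$ (the same limit arises from wired boundary conditions). The quantity $\widehat{\mathcal{O}}_{\Lambda_n}(\beta)$ is the expected number of edges in $\Lambda_n$ shared by two independent samples from $\mathbf{P}^{\omega}_{\infty,\beta}$ with the same $\omega$. *)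

theory Defs
  imports "HOL-Probability.Probability"
begin

text \<open>Vertices are vectors \<^typ>\<open>int ^ 'd\<close>, the dimension being \<^term>\<open>CARD('d)\<close>.  Undirected edges
  are two-element sets of vertices, and a subgraph is given by its set of edges.\<close>

definition lattice_edges :: "(int ^ 'd::finite) set set" where
  "lattice_edges = {{u, v} | u v. (\<Sum>i\<in>UNIV. \<bar>u $ i - v $ i\<bar>) = 1}"

definition lattice_box :: "nat \<Rightarrow> (int ^ 'd::finite) set" where
  "lattice_box n = {x. \<forall>i. \<bar>x $ i\<bar> \<le> int n}"

definition box_edges :: "nat \<Rightarrow> (int ^ 'd::finite) set set" where
  "box_edges n = {e \<in> lattice_edges. e \<subseteq> lattice_box n}"


text \<open>Graph_Theory's spanning trees are not used: a forest there is a digraph without \<^emph>\<open>directed\<close>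
  cycles, so a symmetric digraph with at least one arc is never a forest.\<close>

definition connected_on :: "'v set \<Rightarrow> 'v set set \<Rightarrow> bool" where
  "connected_on V T \<longleftrightarrow> (\<forall>u\<in>V. \<forall>v\<in>V. (u, v) \<in> {(x, y). {x, y} \<in> T}\<^sup>*)"

definition is_cycle :: "'v set set \<Rightarrow> 'v list \<Rightarrow> bool" where
  "is_cycle T xs \<longleftrightarrow> length xs \<ge> 3 \<and> distinct xs \<and>
     (\<forall>i<length xs. {xs ! i, xs ! (Suc i mod length xs)} \<in> T)"

definition spanning_trees :: "'v set \<Rightarrow> 'v set set \<Rightarrow> 'v set set set" where
  "spanning_trees V E = {T. T \<subseteq> E \<and> connected_on V T \<and> (\<nexists>xs. is_cycle T xs)}"


definition tree_weight :: "real \<Rightarrow> ('v set \<Rightarrow> real) \<Rightarrow> 'v set set \<Rightarrow> real" where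
  "tree_weight \<beta> \<omega> T = (\<Prod>e\<in>T. exp (- \<beta> * \<omega> e))"

definition free_tree_measure ::
  "real \<Rightarrow> ((int ^ 'd::finite) set \<Rightarrow> real) \<Rightarrow> nat \<Rightarrow> (int ^ 'd) set set measure" where
  "free_tree_measure \<beta> \<omega> n =
     (let S = spanning_trees (lattice_box n) (box_edges n)
      in point_measure S (\<lambda>T. ennreal (tree_weight \<beta> \<omega> T / (\<Sum>T'\<in>S. tree_weight \<beta> \<omega> T'))))"

text \<open>The \<open>\<sigma>\<close>-algebra on subgraphs is the product one on subsets of the edge set.\<close>

definition subgraph_algebra :: "(int ^ 'd::finite) set set measure" where
  "subgraph_algebra =
     sigma (Pow lattice_edges) {{T \<in> Pow lattice_edges. e \<in> T} | e. e \<in> lattice_edges}"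

definition is_infinite_volume_limit ::
  "real \<Rightarrow> ((int ^ 'd::finite) set \<Rightarrow> real) \<Rightarrow> (int ^ 'd) set set measure \<Rightarrow> bool" where
  "is_infinite_volume_limit \<beta> \<omega> P \<longleftrightarrow>
     prob_space P \<and> sets P = sets subgraph_algebra \<and>
     (\<forall>A \<subseteq> lattice_edges. finite A \<longrightarrow>
        (\<lambda>n. measure (free_tree_measure \<beta> \<omega> n) {T \<in> space (free_tree_measure \<beta> \<omega> n). A \<subseteq> T})
          \<longlonglongrightarrow> measure P {T \<in> space P. A \<subseteq> T})"

text \<open>The events \<open>A \<subseteq> T\<close> with \<open>A\<close> finite form a generating \<open>\<pi>\<close>-system, so a limit is unique if it
  exists.  Where there is no limit, the value below is an unspecified measure.\<close>

definition infinite_tree_measure ::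
  "real \<Rightarrow> ((int ^ 'd::finite) set \<Rightarrow> real) \<Rightarrow> (int ^ 'd) set set measure" where
  "infinite_tree_measure \<beta> \<omega> = (THE P. is_infinite_volume_limit \<beta> \<omega> P)"

definition edge_prob :: "real \<Rightarrow> ((int ^ 'd::finite) set \<Rightarrow> real) \<Rightarrow> (int ^ 'd) set \<Rightarrow> real" where
  "edge_prob \<beta> \<omega> e =
     measure (infinite_tree_measure \<beta> \<omega>) {T \<in> space (infinite_tree_measure \<beta> \<omega>). e \<in> T}"

definition expected_overlap :: "real \<Rightarrow> ((int ^ 'd::finite) set \<Rightarrow> real) \<Rightarrow> nat \<Rightarrow> real" where
  "expected_overlap \<beta> \<omega> n = (\<Sum>e\<in>box_edges n. (edge_prob \<beta> \<omega> e)\<^sup>2)"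


definition environment :: "real measure \<Rightarrow> ((int ^ 'd::finite) set \<Rightarrow> real) measure" where
  "environment \<mu> = (\<Pi>\<^sub>M e\<in>lattice_edges. \<mu>)"

end

theory Submission
  imports Defs "HOL-Real_Asymp.Real_Asymp"
begin

text \<open>
  The proof combines Rayleigh monotonicity, a count of tree edges and a law of large numbers for
  observables that depend on finitely many weights.

  If a finite connected graph \<open>G\<close> is a subgraph of another one, \<open>H\<close>, then
  \<open>P\<^sub>G(A \<subseteq> T) \<ge> P\<^sub>H(A \<subseteq> T)\<close> for every set \<open>A\<close> of edges of \<open>G\<close> (\<open>tree_prob_antimono\<close>).  Edges are put
  into \<open>A\<close> one by one; the step is the electrical statement that an effective resistance can only
  decrease when edges are added, in the network in which the edges of \<open>A\<close> are short-circuited.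
  It follows for \<^emph>\<open>every\<close> environment that \<open>P(A \<subseteq> T)\<close> converges along the boxes, and by Kolmogorov
  extension that the infinite-volume measure exists (\<open>edge_prob_limit\<close>).  Furthermore, the
  limiting probability \<open>p(e)\<close> of an edge is at most its probability \<open>f\<^sub>k(e)\<close> in the translated box of
  radius \<open>k + 1\<close> around \<open>e\<close>, and \<open>f\<^sub>k(e)\<close> tends to \<open>p(e)\<close> as \<open>k\<close> grows.

  The \<open>f\<^sub>k(e)\<close> are identically distributed for all edges \<open>e\<close>, because lattice
  automorphisms act transitively on edges and preserve the law of the environment, and those of
  distant edges are independent.  The variance of an average over the box of radius \<open>n\<close> is thus
  \<open>O(n\<^sup>-\<^sup>d)\<close>, which is summable for \<open>d \<ge> 2\<close>, so the sums of \<open>f\<^sub>k\<close> and of \<open>f\<^sub>k\<^sup>2\<close> over the box, divided by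
  the number \<open>|\<Lambda>\<^sub>n| - 1\<close> of edges of a spanning tree, converge almost surely to \<open>d E f\<^sub>k\<close> and
  \<open>d E f\<^sub>k\<^sup>2\<close> (\<open>local_average\<close>).

  From \<open>0 \<le> p \<le> f\<^sub>k \<le> 1\<close> one has \<open>f\<^sub>k\<^sup>2 - 2 (f\<^sub>k - p) \<le> p\<^sup>2 \<le> f\<^sub>k\<^sup>2\<close>.  The upper bound shows
  that the upper limit of the averages of \<open>p\<^sup>2\<close> is at most \<open>d E p\<^sup>2\<close>.  For the lower bound, the
  averages of \<open>p\<close> itself must be controlled from below, and this is where trees are special: a
  spanning tree of a large box has at least \<open>|\<Lambda>\<^sub>n|\<close> edges touching \<open>\<Lambda>\<^sub>n\<close>, so the sum of \<open>p\<close> over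
  the next larger box is at least \<open>|\<Lambda>\<^sub>n|\<close> in every environment (\<open>sum_edge_prob_ge\<close>); on the other
  hand a spanning tree of \<open>\<Lambda>\<^sub>n\<close> has \<open>|\<Lambda>\<^sub>n| - 1\<close> edges, so that \<open>d E p \<le> 1\<close> (\<open>mean_degree_bound\<close>).
  Hence the averages of \<open>f\<^sub>k - p\<close> have upper limit at most \<open>d E f\<^sub>k - 1\<close>, which tends to
  \<open>d E p - 1 \<le> 0\<close> as \<open>k\<close> grows.
\<close>

section \<open>Forests and connectedness\<close>

definition linked :: "'v set set \<Rightarrow> 'v \<Rightarrow> 'v \<Rightarrow> bool" where
  "linked T x y \<longleftrightarrow> (x, y) \<in> {(x, y). {x, y} \<in> T}\<^sup>*"

text \<open>Acyclicity without paths: the endpoints of an edge are separated by deleting it.  In this form it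
  is easily carried through insertions and deletions of edges; \<open>forest_iff_no_cycle\<close> relates it to cycles.\<close>

definition forest :: "'v set set \<Rightarrow> bool" where
  "forest T \<longleftrightarrow> (\<forall>x y. {x, y} \<in> T \<longrightarrow> \<not> linked (T - {{x, y}}) x y)"

lemma linked_refl [simp]: "linked T x x"
  by (simp add: linked_def)

lemma linked_trans: "linked T x y \<Longrightarrow> linked T y z \<Longrightarrow> linked T x z"
  by (simp add: linked_def)

lemma linked_sym: "linked T x y \<Longrightarrow> linked T y x"
  unfolding linked_def
  by (rule symD[OF sym_rtrancl]) (auto simp: sym_def insert_commute)

lemma linked_commute: "linked T x y \<longleftrightarrow> linked T y x"
  by (blast intro: linked_sym)

lemma linked_edge: "{x, y} \<in> T \<Longrightarrow> linked T x y"
  by (auto simp: linked_def)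

lemma linked_mono: "linked S x y \<Longrightarrow> S \<subseteq> T \<Longrightarrow> linked T x y"
  unfolding linked_def by (rule rtrancl_mono[THEN subsetD]) auto

lemma linked_induct [consumes 1, case_names refl step]:
  assumes "linked T x y" "P x"
    and "\<And>y z. linked T x y \<Longrightarrow> {y, z} \<in> T \<Longrightarrow> P y \<Longrightarrow> P z"
  shows "P y"
  using assms(1) unfolding linked_def
  by (induction rule: rtrancl_induct) (use assms(2,3) in \<open>auto simp: linked_def\<close>)

text \<open>A path through a new edge can be shortened so as to use that edge at most once.\<close>

lemma linked_insert:
  "linked (insert {x, y} T) u v \<longleftrightarrow>
     linked T u v \<or> linked T u x \<and> linked T y v \<or> linked T u y \<and> linked T x v"
  (is "?L \<longleftrightarrow> ?R v")
proof
  show "?R v" if ?L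
    using that
  proof (induction rule: linked_induct)
    case (step v z)
    show ?case
    proof (cases "{v, z} = {x, y}")
      case True
      then show ?thesis using step.IH by (auto simp: doubleton_eq_iff)
    next
      case False
      then have "linked T v z" using step by (auto intro: linked_edge)
      then show ?thesis using step.IH by (blast intro: linked_trans)
    qed
  qed simp
next
  have *: "linked (insert {x, y} T) x y" by (simp add: linked_edge)
  show "?R v \<Longrightarrow> ?L"
    using * linked_sym[OF *] linked_mono[of T _ _ "insert {x, y} T"]
    by (blast intro: linked_trans)
qed

lemma linked_insert_redundant:
  assumes "linked T x y"
  shows "linked (insert {x, y} T) u v \<longleftrightarrow> linked T u v"
proof -
  have "linked T u x \<Longrightarrow> linked T y v \<Longrightarrow> linked T u v"
    by (rule linked_trans[OF linked_trans[OF _ assms]])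
  moreover have "linked T u y \<Longrightarrow> linked T x v \<Longrightarrow> linked T u v"
    by (rule linked_trans[OF linked_trans[OF _ linked_sym[OF assms]]])
  ultimately show ?thesis by (auto simp: linked_insert)
qed

lemma forest_subset: "forest T \<Longrightarrow> S \<subseteq> T \<Longrightarrow> forest S"
  unfolding forest_def by (meson Diff_mono in_mono linked_mono order_refl)

lemma forest_edge_neq: "forest T \<Longrightarrow> {x, y} \<in> T \<Longrightarrow> x \<noteq> y"
  using linked_refl unfolding forest_def by metis

lemma forest_insert:
  assumes "forest F" "\<not> linked F x y"
  shows "forest (insert {x, y} F)"
  unfolding forest_def
proof (intro allI impI notI)
  fix u v assume uv: "{u, v} \<in> insert {x, y} F"
    and l: "linked (insert {x, y} F - {{u, v}}) u v"
  show False
  proof (cases "{u, v} = {x, y}")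
    case True
    then have "linked F u v" using l by (auto intro: linked_mono)
    with True assms(2) show False by (auto simp: doubleton_eq_iff linked_commute)
  next
    case False
    then have uvF: "{u, v} \<in> F" and "linked (insert {x, y} (F - {{u, v}})) u v"
      using uv l by (auto simp: insert_Diff_if)
    then have "linked (F - {{u, v}}) u x \<and> linked (F - {{u, v}}) y v \<or>
        linked (F - {{u, v}}) u y \<and> linked (F - {{u, v}}) x v"
      using assms(1) by (auto simp: linked_insert forest_def)
    then have "linked F u x \<and> linked F y v \<or> linked F u y \<and> linked F x v"
      by (meson Diff_subset linked_mono)
    with linked_edge[OF uvF] assms(2) show False
      by (meson linked_sym linked_trans)
  qed
qed

lemma linked_imp_path:
  assumes "linked T x y"
  shows "\<exists>xs. xs \<noteq> [] \<and> hd xs = x \<and> last xs = y \<and> distinct xs \<and> successively (\<lambda>a b. {a, b} \<in> T) xs"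
  using assms
proof (induction rule: linked_induct)
  case refl
  show ?case by (rule exI[of _ "[x]"]) simp
next
  case (step y z)
  then obtain xs where xs: "xs \<noteq> []" "hd xs = x" "last xs = y" "distinct xs"
    "successively (\<lambda>a b. {a, b} \<in> T) xs" by blast
  show ?case
  proof (cases "z \<in> set xs")
    case True
    then obtain as bs where "xs = as @ z # bs" by (meson split_list)
    then have "successively (\<lambda>a b. {a, b} \<in> T) ((as @ [z]) @ bs)" "hd (as @ [z]) = x"
      "distinct (as @ [z])"
      using xs by (auto simp: hd_append)
    then show ?thesis
      by (intro exI[of _ "as @ [z]"]) (auto simp: successively_append_iff)
  next
    case False
    then show ?thesis using xs step.hyps
      by (intro exI[of _ "xs @ [z]"]) (auto simp: successively_append_iff)
  qed
qed

text \<open>If the ends of an edge stay connected after its deletion, a path that repeats no vertex together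
  with the edge is a cycle; that path has at least two edges because the deleted edge is not available.\<close>

lemma forest_iff_no_cycle:
  assumes "\<And>f. f \<in> T \<Longrightarrow> card f = 2"
  shows "forest T \<longleftrightarrow> (\<nexists>xs. is_cycle T xs)"
proof
  assume T: "forest T"
  show "\<nexists>xs. is_cycle T xs"
  proof
    assume "\<exists>xs. is_cycle T xs"
    then obtain xs where len: "3 \<le> length xs" and d: "distinct xs"
      and e: "\<And>i. i < length xs \<Longrightarrow> {xs ! i, xs ! (Suc i mod length xs)} \<in> T"
      by (auto simp: is_cycle_def)
    define m where "m = length xs - 1"
    have m: "Suc m = length xs" "2 \<le> m" using len by (auto simp: m_def)
    have "xs \<noteq> []" using len by auto
    have "linked (T - {{xs ! m, xs ! 0}}) (xs ! 0) (xs ! i)" if "i \<le> m" for i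
      using that
    proof (induction i)
      case (Suc i)
      have "{xs ! i, xs ! Suc i} \<in> T"
        using e[of i] Suc.prems m by auto
      moreover have "{xs ! i, xs ! Suc i} \<noteq> {xs ! m, xs ! 0}"
        using Suc.prems m \<open>xs \<noteq> []\<close> nth_eq_iff_index_eq[OF d, of i 0] nth_eq_iff_index_eq[OF d, of i m]
          nth_eq_iff_index_eq[OF d, of "Suc i" m]
        by (auto simp: doubleton_eq_iff)
      ultimately show ?case using Suc by (auto intro: linked_trans linked_edge)
    qed simp
    moreover have "{xs ! m, xs ! 0} \<in> T" using e[of m] m by simp
    ultimately show False using T by (auto simp: forest_def linked_commute)
  qed
next
  assume nc: "\<nexists>xs. is_cycle T xs"
  show "forest T"
    unfolding forest_def
  proof (intro allI impI notI)
    fix x y assume xy: "{x, y} \<in> T" and l: "linked (T - {{x, y}}) x y"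
    obtain xs where xs: "xs \<noteq> []" "hd xs = x" "last xs = y" "distinct xs"
      and succ: "successively (\<lambda>a b. {a, b} \<in> T - {{x, y}}) xs"
      using linked_imp_path[OF l] by blast
    have "x \<noteq> y" using assms[OF xy] by auto
    then have "3 \<le> length xs"
      using xs succ by (cases xs; cases "tl xs"; cases "tl (tl xs)") auto
    moreover have "{xs ! i, xs ! (Suc i mod length xs)} \<in> T" if "i < length xs" for i
    proof (cases "Suc i = length xs")
      case True
      then have "xs ! i = last xs" using xs(1) by (simp add: last_conv_nth flip: True)
      then show ?thesis using True xs xy by (auto simp: hd_conv_nth insert_commute)
    next
      case False
      then show ?thesis using that succ by (auto simp: successively_conv_nth)
    qed
    ultimately show False using nc xs(4) by (auto simp: is_cycle_def)
  qed
qed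

lemma mem_spanning_trees_iff:
  assumes "\<And>f. f \<in> E \<Longrightarrow> card f = 2"
  shows "T \<in> spanning_trees V E \<longleftrightarrow> T \<subseteq> E \<and> (\<forall>u\<in>V. \<forall>v\<in>V. linked T u v) \<and> forest T"
  using forest_iff_no_cycle[of T] assms
  by (auto simp: spanning_trees_def connected_on_def linked_def)

text \<open>An inclusion-minimal connected edge set is a forest: an edge whose ends stay connected without it
  could be dropped.\<close>

lemma spanning_trees_nonempty:
  assumes "finite E" "\<And>f. f \<in> E \<Longrightarrow> card f = 2" "connected_on V E"
  shows "spanning_trees V E \<noteq> {}"
proof -
  define C where "C = {T. T \<subseteq> E \<and> (\<forall>u\<in>V. \<forall>v\<in>V. linked T u v)}"
  have "E \<in> C" using assms(3) by (auto simp: C_def connected_on_def linked_def)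
  moreover have "finite C" by (rule finite_subset[of _ "Pow E"]) (use assms(1) in \<open>auto simp: C_def\<close>)
  ultimately obtain T where T: "T \<in> C" and min: "\<And>S. S \<in> C \<Longrightarrow> S \<subseteq> T \<Longrightarrow> S = T"
    using finite_has_minimal[of C] by (metis empty_iff)
  have "forest T"
    unfolding forest_def
  proof (intro allI impI notI)
    fix x y assume xy: "{x, y} \<in> T" and l: "linked (T - {{x, y}}) x y"
    have "insert {x, y} (T - {{x, y}}) = T" using xy by auto
    then have "linked (T - {{x, y}}) u v" if "linked T u v" for u v
      using linked_insert_redundant[OF l, of u v] that by simp
    then have "T - {{x, y}} \<in> C" using T by (auto simp: C_def)
    then show False using min[of "T - {{x, y}}"] xy by auto
  qed
  then have "T \<in> spanning_trees V E"
    using T mem_spanning_trees_iff[OF assms(2), where V=V and T=T] by (auto simp: C_def)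
  then show ?thesis by auto
qed

text \<open>Deleting an edge splits the forest into the part on the component of one end and the part on the
  remaining vertices; both vertex sets are nonempty, and induction applies to each of them.\<close>

lemma forest_card_less:
  assumes "finite V" "V \<noteq> {}" "forest T" "\<And>f. f \<in> T \<Longrightarrow> f \<subseteq> V \<and> card f = 2"
  shows "card T < card V"
  using assms
proof (induction "card V" arbitrary: V T rule: less_induct)
  case less
  have finT: "finite T" by (rule finite_subset[of _ "Pow V"]) (use less.prems in auto)
  show ?case
  proof (cases "T = {}")
    case True
    then show ?thesis using less.prems by (simp add: card_gt_0_iff)
  next
    case False
    then obtain f where f: "f \<in> T" by auto
    then obtain x y where fxy: "f = {x, y}" "x \<noteq> y"
      using less.prems(4) by (metis card_2_iff)
    define C where "C = {v \<in> V. linked (T - {f}) x v}"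
    define T1 where "T1 = {g \<in> T - {f}. g \<subseteq> C}"
    define T2 where "T2 = {g \<in> T - {f}. g \<subseteq> V - C}"
    have xC: "x \<in> C" and yC: "y \<in> V - C"
      using less.prems(3,4) f fxy by (auto simp: C_def forest_def)
    have CV: "C \<subseteq> V" by (auto simp: C_def)
    have *: "g \<in> T1 \<union> T2" if g: "g \<in> T - {f}" for g
    proof -
      obtain u v where uv: "g = {u, v}" using less.prems(4) g by (metis DiffE card_2_iff)
      then have "linked (T - {f}) u v" using g by (auto intro: linked_edge)
      moreover have "u \<in> V" "v \<in> V" using g uv less.prems(4) by auto
      ultimately have "u \<in> C \<longleftrightarrow> v \<in> C" by (auto simp: C_def intro: linked_trans linked_sym)
      then show ?thesis using uv g \<open>u \<in> V\<close> \<open>v \<in> V\<close> by (auto simp: T1_def T2_def)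
    qed
    have TT: "T - {f} = T1 \<union> T2" using * by (auto simp: T1_def T2_def)
    have ne: "g \<noteq> {}" if "g \<in> T" for g using less.prems(4)[OF that] by auto
    have dj: "T1 \<inter> T2 = {}" using ne by (auto simp: T1_def T2_def)
    have "card T1 < card C"
    proof (rule less.hyps)
      show "card C < card V" using CV yC less.prems(1) by (intro psubset_card_mono) auto
      show "forest T1" using less.prems(3) by (rule forest_subset) (auto simp: T1_def)
    qed (use CV xC less.prems in \<open>auto simp: T1_def dest: finite_subset\<close>)
    moreover have "card T2 < card (V - C)"
    proof (rule less.hyps)
      show "card (V - C) < card V" using CV xC less.prems(1) by (intro psubset_card_mono) auto
      show "forest T2" using less.prems(3) by (rule forest_subset) (auto simp: T2_def)
    qed (use CV yC less.prems in \<open>auto simp: T2_def dest: finite_subset\<close>)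
    moreover have "card T = Suc (card T1 + card T2)"
      using f finT dj TT by (metis card.remove card_Un_disjoint finite_Diff finite_Un)
    moreover have "card C + card (V - C) = card V"
      using CV less.prems(1) by (metis card_Diff_subset card_mono finite_subset le_add_diff_inverse)
    ultimately show ?thesis by linarith
  qed
qed

text \<open>Some edge leaves \<open>U\<close>, say at \<open>x\<close>.  It is counted for \<open>U\<close> but not for \<open>U - {x}\<close>, and from every
  vertex of \<open>U - {x}\<close> one can still escape.\<close>

lemma card_le_edges_touching:
  assumes "finite U" "finite T" "\<And>u. u \<in> U \<Longrightarrow> \<exists>v. v \<notin> U \<and> linked T u v"
  shows "card U \<le> card {f \<in> T. f \<inter> U \<noteq> {}}"
  using assms
proof (induction "card U" arbitrary: U)
  case (Suc n)
  then obtain u where "u \<in> U" by fastforce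
  then obtain v where v: "v \<notin> U" "linked T u v" using Suc by blast
  from v(2) have "v \<in> U \<or> (\<exists>x y. {x, y} \<in> T \<and> x \<in> U \<and> y \<notin> U)"
    by (induction rule: linked_induct) (use \<open>u \<in> U\<close> in auto)
  then obtain x y where xy: "{x, y} \<in> T" "x \<in> U" "y \<notin> U" using v by blast
  have "n = card (U - {x})" using Suc xy by simp
  moreover have "\<exists>v. v \<notin> U - {x} \<and> linked T u v" if "u \<in> U - {x}" for u
    using Suc.prems(3) that by blast
  ultimately have "n \<le> card {f \<in> T. f \<inter> (U - {x}) \<noteq> {}}"
    using Suc.hyps(1)[of "U - {x}"] Suc.prems by auto
  also have "\<dots> < card {f \<in> T. f \<inter> U \<noteq> {}}"
  proof (rule psubset_card_mono)
    have "{x, y} \<in> {f \<in> T. f \<inter> U \<noteq> {}} - {f \<in> T. f \<inter> (U - {x}) \<noteq> {}}"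
      using xy by auto
    then show "{f \<in> T. f \<inter> (U - {x}) \<noteq> {}} \<subset> {f \<in> T. f \<inter> U \<noteq> {}}" by blast
  qed (use Suc.prems in auto)
  finally show ?case using Suc.hyps(2) by simp
qed simp

section \<open>Rayleigh monotonicity for spanning trees\<close>

text \<open>Flows and potential differences change sign with the orientation of an edge.  Summing over both
  orientations avoids choosing one, at the price of a factor 2 in the sums below.\<close>

definition arcs :: "'v set set \<Rightarrow> ('v \<times> 'v) set" where
  "arcs T = {(x, y). {x, y} \<in> T}"

lemma mem_arcs [simp]: "(x, y) \<in> arcs T \<longleftrightarrow> {x, y} \<in> T"
  by (simp add: arcs_def)

lemma finite_arcs:
  assumes "finite V" "\<And>f. f \<in> E \<Longrightarrow> f \<subseteq> V"
  shows "finite (arcs E)"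
proof (rule finite_subset)
  show "arcs E \<subseteq> V \<times> V" using assms(2) by fastforce
qed (use assms in auto)

text \<open>The unit flow from \<open>a\<close> to \<open>b\<close> along the path in the tree \<open>T\<close>, without mentioning the path: an edge of
  \<open>T\<close> lies on it iff its deletion separates \<open>a\<close> from \<open>b\<close>, and the direction of travel is from the side
  of \<open>a\<close> to the side of \<open>b\<close>.\<close>

definition tree_flow :: "'v set set \<Rightarrow> 'v \<Rightarrow> 'v \<Rightarrow> 'v \<times> 'v \<Rightarrow> real" where
  "tree_flow T a b = (\<lambda>(x, y). of_bool (linked (T - {{x, y}}) x a) - of_bool (linked (T - {{x, y}}) x b))"

text \<open>Pairing with the differences of a function \<open>g\<close> is a way to say \<open>unit flow from a to b\<close>, by summation
  by parts.  As \<open>tree_flow\<close> is additive along \<open>a \<rightarrow> b \<rightarrow> c\<close>, it suffices that \<open>b\<close> and \<open>c\<close> are adjacent, and then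
  the flow is carried by the edge \<open>{b, c}\<close> alone.\<close>

lemma tree_flow_unit:
  fixes g :: "'v \<Rightarrow> real"
  assumes "forest T" "finite (arcs T)" "linked T a b"
  shows "(\<Sum>(x, y)\<in>arcs T. tree_flow T a b (x, y) * (g x - g y)) = 2 * (g a - g b)"
  using assms(3)
proof (induction rule: linked_induct)
  case refl
  then show ?case by (simp add: tree_flow_def)
next
  case (step b c)
  have bc: "b \<noteq> c" using forest_edge_neq[OF assms(1) step.hyps(2)] .
  have sep: "\<not> linked (T - {{b, c}}) b c"
    using assms(1) step.hyps(2) by (simp add: forest_def)
  then have sep': "\<not> linked (T - {{c, b}}) c b"
    by (metis insert_commute linked_sym)
  have zero: "tree_flow T b c (x, y) = 0" if "{x, y} \<noteq> {b, c}" for x y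
  proof -
    have "linked (T - {{x, y}}) b c" using step.hyps(2) that by (auto intro: linked_edge)
    then have "linked (T - {{x, y}}) x b \<longleftrightarrow> linked (T - {{x, y}}) x c"
      by (meson linked_sym linked_trans)
    then show ?thesis by (simp add: tree_flow_def)
  qed
  have "(\<Sum>(x, y)\<in>arcs T. tree_flow T b c (x, y) * (g x - g y)) =
      (\<Sum>(x, y)\<in>{(b, c), (c, b)}. tree_flow T b c (x, y) * (g x - g y))"
  proof (rule sum.mono_neutral_right)
    show "\<forall>i\<in>arcs T - {(b, c), (c, b)}. (case i of (x, y) \<Rightarrow> tree_flow T b c (x, y) * (g x - g y)) = 0"
    proof
      fix p assume p: "p \<in> arcs T - {(b, c), (c, b)}"
      obtain x y where xy: "p = (x, y)" by fastforce
      then have "{x, y} \<noteq> {b, c}" using p by (auto simp: doubleton_eq_iff)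
      then show "(case p of (x, y) \<Rightarrow> tree_flow T b c (x, y) * (g x - g y)) = 0"
        using zero xy by simp
    qed
  qed (use assms(2) step.hyps(2) in \<open>auto simp: insert_commute\<close>)
  also have "\<dots> = 2 * (g b - g c)"
    using bc sep sep' by (simp add: tree_flow_def)
  finally have "(\<Sum>(x, y)\<in>arcs T. tree_flow T b c (x, y) * (g x - g y)) = 2 * (g b - g c)" .
  moreover have "tree_flow T a c p = tree_flow T a b p + tree_flow T b c p" for p
    by (cases p) (simp add: tree_flow_def)
  ultimately show ?case using step.IH
    by (simp add: distrib_right sum.distrib case_prod_beta)
qed

locale finite_graph =
  fixes V :: "'v set" and E :: "'v set set"
  assumes finite_V: "finite V"
    and edge: "\<And>f. f \<in> E \<Longrightarrow> f \<subseteq> V \<and> card f = 2"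
begin

lemma finite_E: "finite E"
  by (rule finite_subset[of _ "Pow V"]) (use finite_V edge in auto)

lemma finite_arcs_subset: "S \<subseteq> E \<Longrightarrow> finite (arcs S)"
  using finite_arcs[OF finite_V, of S] edge by blast

lemma mem_trees:
  "T \<in> spanning_trees V E \<longleftrightarrow> T \<subseteq> E \<and> (\<forall>u\<in>V. \<forall>v\<in>V. linked T u v) \<and> forest T"
  by (rule mem_spanning_trees_iff) (use edge in auto)

lemma finite_trees: "finite (spanning_trees V E)"
  by (rule finite_subset[of _ "Pow E"]) (use finite_E mem_trees in auto)

lemma insert_edge_tree_separates:
  "insert {x, y} F \<in> spanning_trees V E \<Longrightarrow> {x, y} \<notin> F \<Longrightarrow> \<not> linked F x y"
  by (auto simp: mem_trees forest_def)

text \<open>\<open>F\<close> consists of exactly two trees here, and an edge completes it to a spanning tree iff it joins them.\<close>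

lemma insert_edge_tree_iff:
  assumes ab: "{a, b} \<in> E" "insert {a, b} F \<in> spanning_trees V E" "\<not> linked F a b"
    and xy: "{x, y} \<in> E" "{x, y} \<notin> F"
  shows "insert {x, y} F \<in> spanning_trees V E \<longleftrightarrow> \<not> linked F x y"
proof
  assume "insert {x, y} F \<in> spanning_trees V E"
  then show "\<not> linked F x y" using xy(2) by (rule insert_edge_tree_separates)
next
  assume nxy: "\<not> linked F x y"
  have F: "F \<subseteq> E" "forest F" "\<And>u v. u \<in> V \<Longrightarrow> v \<in> V \<Longrightarrow> linked (insert {a, b} F) u v"
    using ab(2) by (auto simp: mem_trees intro: forest_subset)
  have V: "a \<in> V" "b \<in> V" "x \<in> V" "y \<in> V" using edge[OF ab(1)] edge[OF xy(1)] by auto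
  have side: "linked F a u \<or> linked F b u" if "u \<in> V" for u
    using F(3)[OF V(1) that] by (auto simp: linked_insert)
  have "linked F a x \<and> linked F b y \<or> linked F b x \<and> linked F a y"
    using side[OF V(3)] side[OF V(4)] nxy by (meson linked_sym linked_trans)
  then have "linked (insert {x, y} F) a b"
    unfolding linked_insert by (auto simp: linked_commute)
  then have "linked (insert {x, y} F) u v" if "u \<in> V" "v \<in> V" for u v
    using side[OF that(1)] side[OF that(2)]
    by (meson linked_mono linked_sym linked_trans subset_insertI)
  with F forest_insert[OF F(2) nxy] xy show "insert {x, y} F \<in> spanning_trees V E"
    by (auto simp: mem_trees)
qed

end

text \<open>A network with conductances \<open>w\<close> in which the edges of \<open>A\<close> are short-circuited and a battery is placed
  across the edge \<open>{a, b}\<close>.  Current and voltage are given by Kirchhoff's tree formulas below, up to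
  the common factor \<open>1 / (\<Sum>T\<in>trees. prod w T)\<close>.\<close>

locale network = finite_graph V E for V :: "'v set" and E +
  fixes w :: "'v set \<Rightarrow> real" and A :: "'v set set" and a b :: 'v
  assumes w_pos: "\<And>f. w f > 0"
    and ab: "{a, b} \<in> E" "{a, b} \<notin> A" and A: "A \<subseteq> E"
begin

definition trees :: "'v set set set" where
  "trees = {T \<in> spanning_trees V E. A \<subseteq> T}"

definition two_forests :: "'v set set set" where
  "two_forests = {F. A \<subseteq> F \<and> {a, b} \<notin> F \<and> insert {a, b} F \<in> spanning_trees V E}"

text \<open>Up to normalisation, the mean unit flow along the random tree conditioned to contain \<open>A\<close>.\<close>

definition flow :: "'v \<times> 'v \<Rightarrow> real" where
  "flow = (\<lambda>(x, y). \<Sum>T | T \<in> trees \<and> {x, y} \<in> T. prod w T * tree_flow T a b (x, y))"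

text \<open>The voltage in Kirchhoff's form, with \<open>b\<close> grounded: each forest in \<open>two_forests\<close> keeps \<open>b\<close> away from \<open>a\<close>.\<close>

definition potential :: "'v \<Rightarrow> real" where
  "potential x = (\<Sum>F\<in>two_forests. prod w F * of_bool (linked F a x))"

lemma finite_sets: "finite trees" "finite two_forests"
proof -
  show "finite trees" using finite_trees by (simp add: trees_def)
  show "finite two_forests"
    by (rule finite_subset[of _ "Pow E"]) (use finite_E in \<open>auto simp: two_forests_def mem_trees\<close>)
qed

lemma two_forestsD:
  assumes "F \<in> two_forests"
  shows "A \<subseteq> F" "F \<subseteq> E" "\<not> linked F a b" "\<And>v. v \<in> V \<Longrightarrow> linked F a v \<longleftrightarrow> \<not> linked F b v"
proof -
  show *: "A \<subseteq> F" "F \<subseteq> E" "\<not> linked F a b"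
    using assms ab by (auto simp: two_forests_def mem_trees forest_def)
  have "a \<in> V" using edge[OF ab(1)] by auto
  then have "linked (insert {a, b} F) a v" if "v \<in> V" for v
    using assms that by (auto simp: two_forests_def mem_trees)
  then have "linked F a v \<or> linked F b v" if "v \<in> V" for v
    using that by (auto simp: linked_insert)
  then show "linked F a v \<longleftrightarrow> \<not> linked F b v" if "v \<in> V" for v
    using *(3) that by (meson linked_sym linked_trans)
qed

lemma flow_unit:
  "(\<Sum>(x, y)\<in>arcs E. flow (x, y) * (g x - g y)) = 2 * (\<Sum>T\<in>trees. prod w T) * (g a - g b)"
proof -
  have "(\<Sum>(x, y)\<in>arcs E. flow (x, y) * (g x - g y)) =
      (\<Sum>p\<in>arcs E. \<Sum>T | T \<in> trees \<and> {fst p, snd p} \<in> T.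
         prod w T * (tree_flow T a b p * (g (fst p) - g (snd p))))"
    by (intro sum.cong) (auto simp: flow_def sum_distrib_right mult.assoc)
  also have "\<dots> = (\<Sum>T\<in>trees. \<Sum>p | p \<in> arcs E \<and> {fst p, snd p} \<in> T.
         prod w T * (tree_flow T a b p * (g (fst p) - g (snd p))))"
    by (rule sum.swap_restrict) (auto simp: finite_sets finite_arcs_subset)
  also have "\<dots> = (\<Sum>T\<in>trees. prod w T * (2 * (g a - g b)))"
  proof (intro sum.cong refl)
    fix T assume "T \<in> trees"
    then have T: "T \<subseteq> E" "forest T" "\<And>u v. u \<in> V \<Longrightarrow> v \<in> V \<Longrightarrow> linked T u v"
      by (auto simp: trees_def mem_trees)
    have "{p. p \<in> arcs E \<and> {fst p, snd p} \<in> T} = arcs T" using T(1) by auto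
    moreover have "linked T a b" using T(3) edge[OF ab(1)] by auto
    ultimately show "(\<Sum>p | p \<in> arcs E \<and> {fst p, snd p} \<in> T.
         prod w T * (tree_flow T a b p * (g (fst p) - g (snd p)))) = prod w T * (2 * (g a - g b))"
      using tree_flow_unit[OF T(2) finite_arcs_subset[OF T(1)], of a b g]
      by (simp add: case_prod_beta flip: sum_distrib_left)
  qed
  finally show ?thesis by (simp add: sum_distrib_right sum_distrib_left mult_ac)
qed

text \<open>Ohm's law.  Removing \<open>{x, y}\<close> from a tree that sends flow through it leaves a two-component forest that
  separates both \<open>a\<close> from \<open>b\<close> and \<open>x\<close> from \<open>y\<close>, and conversely each such forest arises from the tree
  obtained by adding \<open>{x, y}\<close>.\<close>

lemma flow_eq_conductance_potential:
  assumes xy: "{x, y} \<in> E - A"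
  shows "flow (x, y) = w {x, y} * (potential x - potential y)"
proof -
  let ?f = "{x, y}"
  define G where "G = {F. A \<subseteq> F \<and> ?f \<notin> F \<and> insert ?f F \<in> spanning_trees V E}"
  have finG: "finite G"
    by (rule finite_subset[of _ "Pow E"]) (use finite_E in \<open>auto simp: G_def mem_trees\<close>)
  have V: "x \<in> V" "y \<in> V" using edge[of ?f] xy by auto
  have "flow (x, y) = (\<Sum>F\<in>G. w ?f * (prod w F * (of_bool (linked F x a) - of_bool (linked F x b))))"
    unfolding flow_def prod.case
  proof (rule sum.reindex_bij_witness[where i="insert ?f" and j="\<lambda>T. T - {?f}"])
    fix T assume T: "T \<in> {T \<in> trees. ?f \<in> T}"
    show "insert ?f (T - {?f}) = T" using T by auto
    then show "T - {?f} \<in> G" using T xy by (auto simp: G_def trees_def)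
    have "finite T" using T finite_E by (auto simp: trees_def mem_trees dest: finite_subset)
    then have "prod w T = w ?f * prod w (T - {?f})" using T by (simp add: prod.remove)
    then show "w ?f * (prod w (T - {?f}) * (of_bool (linked (T - {?f}) x a) - of_bool (linked (T - {?f}) x b)))
        = prod w T * tree_flow T a b (x, y)"
      by (simp add: tree_flow_def)
  qed (use xy in \<open>auto simp: G_def trees_def\<close>)
  also have "\<dots> = (\<Sum>F\<in>{F \<in> G. \<not> linked F a b}. w ?f * (prod w F * (of_bool (linked F x a) - of_bool (linked F x b))))"
  proof (rule sum.mono_neutral_right)
    have "linked F x a \<longleftrightarrow> linked F x b" if "linked F a b" for F
      using that by (meson linked_sym linked_trans)
    then show "\<forall>F\<in>G - {F \<in> G. \<not> linked F a b}.
        w ?f * (prod w F * (of_bool (linked F x a) - of_bool (linked F x b))) = 0" by auto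
  qed (use finG in auto)
  \<comment> \<open>The roles of \<open>{a, b}\<close> and \<open>{x, y}\<close> are symmetric for a two-component forest that separates both pairs.\<close>
  also have "{F \<in> G. \<not> linked F a b} = {F \<in> two_forests. \<not> linked F x y}"
  proof -
    have "?f \<notin> F \<and> insert ?f F \<in> spanning_trees V E \<and> \<not> linked F a b \<longleftrightarrow>
        {a, b} \<notin> F \<and> insert {a, b} F \<in> spanning_trees V E \<and> \<not> linked F x y" for F
      using insert_edge_tree_iff[of a b F x y] insert_edge_tree_iff[of x y F a b] xy ab
        insert_edge_tree_separates[of a b F] insert_edge_tree_separates[of x y F]
        linked_edge[of a b F] linked_edge[of x y F] by blast
    then show ?thesis by (auto simp: G_def two_forests_def)
  qed
  also have "(\<Sum>F\<in>{F \<in> two_forests. \<not> linked F x y}. w ?f * (prod w F * (of_bool (linked F x a) - of_bool (linked F x b))))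
      = (\<Sum>F\<in>{F \<in> two_forests. \<not> linked F x y}. w ?f * (prod w F * (of_bool (linked F a x) - of_bool (linked F a y))))"
  proof (intro sum.cong refl)
    fix F assume "F \<in> {F \<in> two_forests. \<not> linked F x y}"
    then have F: "F \<in> two_forests" "\<not> linked F x y" by auto
    have "linked F x a \<longleftrightarrow> linked F a x" "linked F x b \<longleftrightarrow> \<not> linked F a x"
      using two_forestsD(4)[OF F(1) V(1)] by (auto simp: linked_commute)
    moreover have "linked F a y \<longleftrightarrow> \<not> linked F a x"
      using two_forestsD(4)[OF F(1) V(1)] two_forestsD(4)[OF F(1) V(2)] F(2)
      by (meson linked_sym linked_trans)
    ultimately show "w ?f * (prod w F * (of_bool (linked F x a) - of_bool (linked F x b))) =
        w ?f * (prod w F * (of_bool (linked F a x) - of_bool (linked F a y)))" by simp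
  qed
  also have "\<dots> = (\<Sum>F\<in>two_forests. w ?f * (prod w F * (of_bool (linked F a x) - of_bool (linked F a y))))"
  proof (rule sum.mono_neutral_left)
    have "linked F a x \<longleftrightarrow> linked F a y" if "linked F x y" for F
      using that by (meson linked_sym linked_trans)
    then show "\<forall>F\<in>two_forests - {F \<in> two_forests. \<not> linked F x y}.
        w ?f * (prod w F * (of_bool (linked F a x) - of_bool (linked F a y))) = 0" by auto
  qed (use finite_sets in auto)
  finally show ?thesis
    by (simp add: potential_def sum_distrib_left right_diff_distrib sum_subtractf)
qed

lemma potential_const_on_A:
  assumes "{x, y} \<in> A"
  shows "potential x = potential y"
proof -
  have "linked F a x \<longleftrightarrow> linked F a y" if "F \<in> two_forests" for F
    using linked_edge[of x y F] two_forestsD(1)[OF that] assms by (meson in_mono linked_sym linked_trans)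
  then show ?thesis by (auto simp: potential_def intro!: sum.cong)
qed

text \<open>The flow through \<open>{a, b}\<close> counts exactly the trees that contain this edge.  Hence the probability of
  the edge, given that the tree contains \<open>A\<close>, is its conductance times the effective resistance between its ends.\<close>

lemma weight_through_ab:
  "(\<Sum>T | T \<in> trees \<and> {a, b} \<in> T. prod w T) = w {a, b} * (potential a - potential b)"
proof -
  have "tree_flow T a b (a, b) = 1" if "T \<in> trees" "{a, b} \<in> T" for T
    using that by (auto simp: tree_flow_def trees_def mem_trees forest_def)
  then have "(\<Sum>T | T \<in> trees \<and> {a, b} \<in> T. prod w T) = flow (a, b)"
    by (simp add: flow_def)
  with flow_eq_conductance_potential[of a b] ab show ?thesis by simp
qed

text \<open>Ohm's law turns the pairing of the flow with \<open>g\<close> into a mixed energy; the edges of \<open>A\<close> drop out because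
  \<open>g\<close> is constant along them.  This applies both to the network's own potential and to the potential of a larger network, in which
  the edges of \<open>A\<close> are short-circuited as well.\<close>

lemma flow_pairing:
  assumes "\<And>x y. {x, y} \<in> A \<Longrightarrow> g x = g y"
  shows "(\<Sum>(x, y)\<in>arcs (E - A). w {x, y} * (potential x - potential y) * (g x - g y)) =
    2 * (\<Sum>T\<in>trees. prod w T) * (g a - g b)"
proof -
  have "(\<Sum>(x, y)\<in>arcs E. flow (x, y) * (g x - g y)) = (\<Sum>(x, y)\<in>arcs (E - A). flow (x, y) * (g x - g y))"
    by (rule sum.mono_neutral_right) (use assms in \<open>auto simp: finite_arcs_subset\<close>)
  also have "\<dots> = (\<Sum>(x, y)\<in>arcs (E - A). w {x, y} * (potential x - potential y) * (g x - g y))"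
    by (rule sum.cong) (auto simp: flow_eq_conductance_potential)
  finally show ?thesis using flow_unit[of g] by simp
qed

end

text \<open>Let \<open>h\<close>, \<open>h'\<close> be the potentials and \<open>z\<close>, \<open>z'\<close> the total tree weights of the smaller and the larger
  network.  By \<open>flow_pairing\<close> the energy of \<open>h\<close> in the smaller network is \<open>2 z (h a - h b)\<close>, its mixed energy
  with \<open>h'\<close> is \<open>2 z (h' a - h' b)\<close>, and the energy of \<open>h'\<close> in the smaller network is at most its energy
  \<open>2 z' (h' a - h' b)\<close> in the larger one.  That the energy of \<open>z' h - z h'\<close> is nonnegative then gives
  \<open>z (h' a - h' b) \<le> z' (h a - h b)\<close>, which by \<open>weight_through_ab\<close> compares the conditional probabilities of
  the edge \<open>{a, b}\<close> given that the tree contains \<open>A\<close>.\<close>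

lemma rayleigh_monotonicity:
  assumes G: "network V E w A a b" and H: "network V' E' w A a b" and EE': "E \<subseteq> E'"
  shows "(\<Sum>T | T \<in> spanning_trees V' E' \<and> insert {a, b} A \<subseteq> T. prod w T) *
      (\<Sum>T | T \<in> spanning_trees V E \<and> A \<subseteq> T. prod w T)
    \<le> (\<Sum>T | T \<in> spanning_trees V E \<and> insert {a, b} A \<subseteq> T. prod w T) *
      (\<Sum>T | T \<in> spanning_trees V' E' \<and> A \<subseteq> T. prod w T)"
proof -
  interpret G: network V E w A a b by fact
  interpret H: network V' E' w A a b by fact
  define z where "z = (\<Sum>T\<in>G.trees. prod w T)"
  define z' where "z' = (\<Sum>T\<in>H.trees. prod w T)"
  define h where "h = G.potential"
  define h' where "h' = H.potential"
  define u where "u = w {a, b}"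
  have zt: "(\<Sum>T | T \<in> spanning_trees V E \<and> A \<subseteq> T. prod w T) = z"
    "(\<Sum>T | T \<in> spanning_trees V' E' \<and> A \<subseteq> T. prod w T) = z'"
    by (simp_all add: z_def z'_def G.trees_def H.trees_def)
  have "{T. T \<in> spanning_trees V E \<and> insert {a, b} A \<subseteq> T} = {T. T \<in> G.trees \<and> {a, b} \<in> T}"
    "{T. T \<in> spanning_trees V' E' \<and> insert {a, b} A \<subseteq> T} = {T. T \<in> H.trees \<and> {a, b} \<in> T}"
    by (auto simp: G.trees_def H.trees_def)
  then have ze: "(\<Sum>T | T \<in> spanning_trees V E \<and> insert {a, b} A \<subseteq> T. prod w T) = u * (h a - h b)"
    "(\<Sum>T | T \<in> spanning_trees V' E' \<and> insert {a, b} A \<subseteq> T. prod w T) = u * (h' a - h' b)"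
    using G.weight_through_ab H.weight_through_ab by (simp_all add: u_def h_def h'_def)
  have u: "u > 0" using G.w_pos by (simp add: u_def)
  have w: "w f \<ge> 0" for f using G.w_pos[of f] by simp
  have z: "z \<ge> 0" "z' \<ge> 0"
    using w by (auto simp: z_def z'_def intro!: sum_nonneg prod_nonneg)
  have Z: "(\<Sum>T | T \<in> H.trees \<and> {a, b} \<in> T. prod w T) \<le> z'"
    unfolding z'_def using w
    by (intro sum_mono2 H.finite_sets) (auto intro!: prod_nonneg)
  have en1: "(\<Sum>(x, y)\<in>arcs (E - A). w {x, y} * (h x - h y)\<^sup>2) = 2 * z * (h a - h b)"
    using G.flow_pairing[of G.potential] G.potential_const_on_A
    by (simp add: h_def z_def power2_eq_square mult.assoc)
  have en2: "(\<Sum>(x, y)\<in>arcs (E - A). w {x, y} * (h x - h y) * (h' x - h' y)) = 2 * z * (h' a - h' b)"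
    using G.flow_pairing[of H.potential] H.potential_const_on_A
    by (simp add: h_def h'_def z_def)
  have "(\<Sum>(x, y)\<in>arcs (E - A). w {x, y} * (h' x - h' y)\<^sup>2) \<le>
      (\<Sum>(x, y)\<in>arcs (E' - A). w {x, y} * (h' x - h' y)\<^sup>2)"
    using EE' w by (intro sum_mono2) (auto simp: H.finite_arcs_subset)
  also have "\<dots> = 2 * z' * (h' a - h' b)"
    using H.flow_pairing[of H.potential] H.potential_const_on_A
    by (simp add: h'_def z'_def power2_eq_square mult.assoc)
  finally have en3: "(\<Sum>(x, y)\<in>arcs (E - A). w {x, y} * (h' x - h' y)\<^sup>2) \<le> 2 * z' * (h' a - h' b)" .
  \<comment> \<open>The factors \<open>z'\<close> and \<open>z\<close> compensate for the missing normalisation of the two potentials.\<close>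
  have "0 \<le> (\<Sum>(x, y)\<in>arcs (E - A). w {x, y} * (z' * (h x - h y) - z * (h' x - h' y))\<^sup>2)"
    using w by (intro sum_nonneg) auto
  also have "\<dots> = (\<Sum>p\<in>arcs (E - A). z'\<^sup>2 * (w {fst p, snd p} * (h (fst p) - h (snd p))\<^sup>2)
      - 2 * z * z' * (w {fst p, snd p} * (h (fst p) - h (snd p)) * (h' (fst p) - h' (snd p)))
      + z\<^sup>2 * (w {fst p, snd p} * (h' (fst p) - h' (snd p))\<^sup>2))"
    by (intro sum.cong) (auto simp: power2_eq_square algebra_simps)
  also have "\<dots> = z'\<^sup>2 * (2 * z * (h a - h b)) - 2 * z * z' * (2 * z * (h' a - h' b))
      + z\<^sup>2 * (\<Sum>(x, y)\<in>arcs (E - A). w {x, y} * (h' x - h' y)\<^sup>2)"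
    unfolding en1[symmetric] en2[symmetric]
    by (simp add: sum.distrib sum_subtractf sum_distrib_left case_prod_beta)
  also have "\<dots> \<le> z'\<^sup>2 * (2 * z * (h a - h b)) - 2 * z * z' * (2 * z * (h' a - h' b))
      + z\<^sup>2 * (2 * z' * (h' a - h' b))"
    using en3 by (intro add_left_mono mult_left_mono) auto
  also have "\<dots> = 2 * (z * z') * (z' * (h a - h b) - z * (h' a - h' b))"
    by (simp add: power2_eq_square algebra_simps)
  finally have main: "0 \<le> 2 * (z * z') * (z' * (h a - h b) - z * (h' a - h' b))" .
  have nn: "0 \<le> u * (h a - h b)" "0 \<le> u * (h' a - h' b)"
    unfolding ze[symmetric] by (intro sum_nonneg prod_nonneg w)+
  consider "z = 0" | "z' = 0" | "z > 0" "z' > 0" using z by linarith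
  then have "u * (h' a - h' b) * z \<le> u * (h a - h b) * z'"
  proof cases
    case 1
    then show ?thesis using nn z by simp
  next
    case 2
    then have "u * (h' a - h' b) = 0" using Z nn by (simp add: H.weight_through_ab u_def h'_def)
    then show ?thesis using 2 by (simp only: mult_zero_left mult_zero_right order_refl)
  next
    case 3
    then have "0 < 2 * (z * z')" by simp
    then have "0 \<le> z' * (h a - h b) - z * (h' a - h' b)"
      using main by (metis zero_le_mult_iff not_le)
    then have "u * (z * (h' a - h' b)) \<le> u * (z' * (h a - h b))"
      using u by (intro mult_left_mono) auto
    then show ?thesis by (simp add: mult_ac)
  qed
  then show ?thesis unfolding zt ze .
qed

text \<open>The probability that the random spanning tree contains \<open>A\<close>, as a quotient of finite sums, so that its
  dependence on the weights stays visible.\<close>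

definition tree_prob :: "('v set \<Rightarrow> real) \<Rightarrow> 'v set \<Rightarrow> 'v set set \<Rightarrow> 'v set set \<Rightarrow> real" where
  "tree_prob w V E A =
     (\<Sum>T | T \<in> spanning_trees V E \<and> A \<subseteq> T. prod w T) / (\<Sum>T\<in>spanning_trees V E. prod w T)"

lemma (in finite_graph) partition_function_pos:
  fixes w :: "'v set \<Rightarrow> real"
  assumes "connected_on V E" "\<And>f. w f > 0"
  shows "(\<Sum>T\<in>spanning_trees V E. prod w T) > 0"
  using spanning_trees_nonempty[OF finite_E _ assms(1)] edge finite_trees assms(2)
  by (intro sum_pos) (auto intro!: prod_pos)

text \<open>By induction on \<open>A\<close>, multiplying the conditional probabilities compared by \<open>rayleigh_monotonicity\<close>.\<close>

lemma tree_prob_antimono: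
  assumes G: "finite_graph V E" "connected_on V E" and H: "finite_graph V' E'" "connected_on V' E'"
    and EE': "E \<subseteq> E'" and w: "\<And>f. w f > 0" and A: "A \<subseteq> E"
  shows "tree_prob w V' E' A \<le> tree_prob w V E A"
proof -
  interpret G: finite_graph V E by fact
  interpret H: finite_graph V' E' by fact
  define Z where "Z A = (\<Sum>T | T \<in> spanning_trees V E \<and> A \<subseteq> T. prod w T)" for A
  define Z' where "Z' A = (\<Sum>T | T \<in> spanning_trees V' E' \<and> A \<subseteq> T. prod w T)" for A
  have pos: "Z {} > 0" "Z' {} > 0"
    using G.partition_function_pos[OF G(2) w] H.partition_function_pos[OF H(2) w]
    by (simp_all add: Z_def Z'_def)
  have w0: "w f \<ge> 0" for f using w[of f] by simp
  have nn: "Z A \<ge> 0" "Z' A \<ge> 0" for A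
    using w0 by (auto simp: Z_def Z'_def intro!: sum_nonneg prod_nonneg)
  have mono: "Z' (insert f A) \<le> Z' A" for f A
    unfolding Z'_def using w0 H.finite_trees
    by (intro sum_mono2) (auto intro!: prod_nonneg)
  have "finite A" using A G.finite_E finite_subset by blast
  then have "Z' A * Z {} \<le> Z A * Z' {}"
    using A
  proof (induction A rule: finite_induct)
    case (insert f A)
    obtain a b where f: "f = {a, b}" using G.edge[of f] insert.prems by (metis card_2_iff insertI1 subsetD)
    have "network V E w A a b" "network V' E' w A a b"
      using insert.prems insert.hyps f w EE' G(1) H(1)
      by (auto simp: network_def network_axioms_def)
    from rayleigh_monotonicity[OF this EE']
    have step: "Z' (insert f A) * Z A \<le> Z (insert f A) * Z' A"
      by (simp add: Z_def Z'_def f)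
    have IH: "Z' A * Z {} \<le> Z A * Z' {}" using insert by auto
    show ?case
    proof (cases "Z' A = 0")
      case True
      then have "Z' (insert f A) = 0" using mono[of f A] nn[of "insert f A"] by simp
      then show ?thesis using nn pos by (simp add: less_imp_le)
    next
      case False
      then have "Z' A > 0" using nn[of A] by simp
      have "(Z' (insert f A) * Z {}) * Z' A = Z' (insert f A) * (Z' A * Z {})" by simp
      also have "\<dots> \<le> Z' (insert f A) * (Z A * Z' {})"
        by (rule mult_left_mono[OF IH nn(2)])
      also have "\<dots> = (Z' (insert f A) * Z A) * Z' {}" by simp
      also have "\<dots> \<le> (Z (insert f A) * Z' A) * Z' {}"
        using step pos by (intro mult_right_mono) auto
      also have "\<dots> = (Z (insert f A) * Z' {}) * Z' A" by simp
      finally show ?thesis using \<open>Z' A > 0\<close> by (rule mult_right_le_imp_le)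
    qed
  qed simp
  then have "Z' A / Z' {} \<le> Z A / Z {}" using pos by (simp add: divide_simps mult_ac)
  then show ?thesis by (simp add: tree_prob_def Z_def Z'_def)
qed

section \<open>Limits of laws of random subsets\<close>

text \<open>Inclusion and exclusion expresses the law of \<open>T \<inter> J\<close> through the probabilities of the events \<open>A \<subseteq> T\<close>.\<close>

lemma random_subset_cylinder_convergent:
  fixes M :: "nat \<Rightarrow> 'e set measure"
  assumes M: "\<And>n. prob_space (M n)" "\<And>n. sets (M n) = Pow (space (M n))"
    and conv: "\<And>A. finite A \<Longrightarrow> A \<subseteq> L \<Longrightarrow> convergent (\<lambda>n. measure (M n) {T \<in> space (M n). A \<subseteq> T})"
    and "finite J" "J \<subseteq> L" "B \<subseteq> J"
  shows "convergent (\<lambda>n. measure (M n) {T \<in> space (M n). T \<inter> J = B})"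
proof -
  have *: "convergent (\<lambda>n. measure (M n) {T \<in> space (M n). A \<subseteq> T \<and> T \<inter> C = {}})"
    if "finite C" "finite A" "A \<subseteq> L" "C \<subseteq> L" for A C
    using that
  proof (induction C arbitrary: A rule: finite_induct)
    case empty
    then show ?case using conv by simp
  next
    case (insert e C)
    have "measure (M n) {T \<in> space (M n). A \<subseteq> T \<and> T \<inter> insert e C = {}} =
        measure (M n) {T \<in> space (M n). A \<subseteq> T \<and> T \<inter> C = {}} -
        measure (M n) {T \<in> space (M n). insert e A \<subseteq> T \<and> T \<inter> C = {}}" for n
    proof -
      interpret prob_space "M n" by (rule M)
      have "{T \<in> space (M n). A \<subseteq> T \<and> T \<inter> insert e C = {}} =
          {T \<in> space (M n). A \<subseteq> T \<and> T \<inter> C = {}} - {T \<in> space (M n). insert e A \<subseteq> T \<and> T \<inter> C = {}}"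
        by auto
      then show ?thesis
        by (simp add: finite_measure_Diff M(2) Pow_def subset_eq)
    qed
    then show ?case
      using convergent_diff[OF insert.IH[of A] insert.IH[of "insert e A"]] insert.prems by simp
  qed
  have "{T \<in> space (M n). T \<inter> J = B} = {T \<in> space (M n). B \<subseteq> T \<and> T \<inter> (J - B) = {}}" for n
    using assms(6) by auto
  then show ?thesis
    using *[of "J - B" B] assms(4-6) by (auto dest: finite_subset)
qed

lemma superset_event_measurable:
  assumes "A \<subseteq> L" "finite A"
  shows "{T \<in> Pow L. A \<subseteq> T} \<in> sigma_sets (Pow L) {{T \<in> Pow L. e \<in> T} | e. e \<in> L}" (is "_ \<in> sigma_sets _ ?G")
proof -
  interpret sigma_algebra "Pow L" "sigma_sets (Pow L) ?G"
    by (rule sigma_algebra_sigma_sets) auto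
  show ?thesis
    using assms(2,1)
  proof (induction A rule: finite_induct)
    case empty
    then show ?case using top by (simp add: Pow_def)
  next
    case (insert e A)
    have "{T \<in> Pow L. insert e A \<subseteq> T} = {T \<in> Pow L. e \<in> T} \<inter> {T \<in> Pow L. A \<subseteq> T}" by auto
    moreover have "{T \<in> Pow L. e \<in> T} \<in> sigma_sets (Pow L) ?G"
      using insert.prems by (intro sigma_sets.Basic) blast
    ultimately show ?case using insert.IH insert.prems by (simp only: Int insert_subset)
  qed
qed

text \<open>Subsets of \<open>L\<close> are encoded by their indicator functions.  The limits of the laws of \<open>T \<inter> J\<close>, for finite
  \<open>J\<close>, form a projective family of measures on real-valued functions, and Kolmogorov's extension theorem
  provides a measure with these marginals.\<close>

lemma random_subset_limit_exists:
  fixes M :: "nat \<Rightarrow> 'e set measure" and L :: "'e set"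
  assumes M: "\<And>n. prob_space (M n)" "\<And>n. sets (M n) = Pow (space (M n))"
    and conv: "\<And>A. finite A \<Longrightarrow> A \<subseteq> L \<Longrightarrow> convergent (\<lambda>n. measure (M n) {T \<in> space (M n). A \<subseteq> T})"
  shows "\<exists>P. prob_space P \<and> sets P = sets (sigma (Pow L) {{T \<in> Pow L. e \<in> T} | e. e \<in> L}) \<and>
    (\<forall>A\<subseteq>L. finite A \<longrightarrow> (\<lambda>n. measure (M n) {T \<in> space (M n). A \<subseteq> T})
       \<longlonglongrightarrow> measure P {T \<in> space P. A \<subseteq> T})"
proof -
  define r where "r J B = lim (\<lambda>n. measure (M n) {T \<in> space (M n). T \<inter> J = B})" for J B
  have r: "(\<lambda>n. measure (M n) {T \<in> space (M n). T \<inter> J = B}) \<longlonglongrightarrow> r J B"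
    if "finite J" "J \<subseteq> L" "B \<subseteq> J" for J B
    unfolding r_def convergent_LIMSEQ_iff[symmetric]
    using M conv that by (rule random_subset_cylinder_convergent) 
  have r_nonneg: "0 \<le> r J B" if "finite J" "J \<subseteq> L" "B \<subseteq> J" for J B
    by (rule LIMSEQ_le_const[OF r[OF that]]) auto
  \<comment> \<open>For empty \<open>J\<close> this says that the masses add up to one, in general it is the consistency of the family.\<close>
  have r_sum: "(\<Sum>B' | B' \<subseteq> H \<and> B' \<inter> J = B. r H B') = r J B"
    if H: "finite H" "H \<subseteq> L" and J: "J \<subseteq> H" "B \<subseteq> J" for H J B
  proof -
    have "(\<lambda>n. \<Sum>B' | B' \<subseteq> H \<and> B' \<inter> J = B. measure (M n) {T \<in> space (M n). T \<inter> H = B'}) \<longlonglongrightarrow>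
        (\<Sum>B' | B' \<subseteq> H \<and> B' \<inter> J = B. r H B')"
      using r[OF H] by (intro tendsto_sum) auto
    moreover have "(\<Sum>B' | B' \<subseteq> H \<and> B' \<inter> J = B. measure (M n) {T \<in> space (M n). T \<inter> H = B'}) =
        measure (M n) {T \<in> space (M n). T \<inter> J = B}" for n
    proof -
      interpret prob_space "M n" by (rule M)
      have fin: "finite {B'. B' \<subseteq> H \<and> B' \<inter> J = B}"
        by (rule finite_subset[of _ "Pow H"]) (use H in auto)
      have "(\<Sum>B' | B' \<subseteq> H \<and> B' \<inter> J = B. measure (M n) {T \<in> space (M n). T \<inter> H = B'}) =
          measure (M n) (\<Union>B'\<in>{B'. B' \<subseteq> H \<and> B' \<inter> J = B}. {T \<in> space (M n). T \<inter> H = B'})"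
        by (rule finite_measure_finite_Union[OF fin, symmetric])
          (auto simp: M(2) disjoint_family_on_def)
      also have "(\<Union>B'\<in>{B'. B' \<subseteq> H \<and> B' \<inter> J = B}. {T \<in> space (M n). T \<inter> H = B'}) =
          {T \<in> space (M n). T \<inter> J = B}"
        using J by auto
      finally show ?thesis .
    qed
    moreover have "(\<lambda>n. measure (M n) {T \<in> space (M n). T \<inter> J = B}) \<longlonglongrightarrow> r J B"
      using r[of J B] H J by (auto dest: finite_subset)
    ultimately show ?thesis using LIMSEQ_unique by simp
  qed
  have r_empty: "r {} {} = 1"
  proof -
    have "(\<lambda>n. measure (M n) {T \<in> space (M n). T \<inter> {} = {}}) = (\<lambda>n. 1)"
      using M(1) by (auto simp: prob_space.prob_space)
    then show ?thesis using r[of "{}" "{}"] LIMSEQ_unique[of "\<lambda>n. 1 :: real" _ 1] by simp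
  qed
  define N where "N J = point_measure (Pow J) (\<lambda>B. ennreal (r J B))" for J
  define ind where "ind J B = (\<lambda>e\<in>J. of_bool (e \<in> B) :: real)" for J B :: "'e set"
  define P where "P J = distr (N J) (Pi\<^sub>M J (\<lambda>_. borel)) (ind J)" for J
  have sets_N: "sets (N J) = Pow (Pow J)" "space (N J) = Pow J" for J
    by (simp_all add: N_def sets_point_measure space_point_measure)
  have emeasure_N: "emeasure (N J) X = ennreal (\<Sum>B\<in>X. r J B)" if "finite J" "J \<subseteq> L" "X \<subseteq> Pow J" for J X
    using that r_nonneg[OF that(1,2)] unfolding N_def
    by (subst emeasure_point_measure_finite) (auto simp: subset_eq intro!: sum_ennreal)
  have ind_meas: "ind J' \<in> N J \<rightarrow>\<^sub>M Pi\<^sub>M J' (\<lambda>_. borel)" for J J'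
    by (rule measurableI) (auto simp: sets_N ind_def space_PiM)
  have N_restrict: "distr (N H) (count_space (Pow J)) (\<lambda>B. B \<inter> J) = N J"
    if H: "finite H" "H \<subseteq> L" and J: "J \<subseteq> H" for H J
  proof (rule measure_eqI_finite)
    have [measurable]: "(\<lambda>B. B \<inter> J) \<in> N H \<rightarrow>\<^sub>M count_space (Pow J)"
      by (rule measurableI) (auto simp: sets_N)
    fix B assume B: "B \<in> Pow J"
    have "emeasure (distr (N H) (count_space (Pow J)) (\<lambda>B. B \<inter> J)) {B} =
        emeasure (N H) {B'. B' \<subseteq> H \<and> B' \<inter> J = B}"
      using B by (subst emeasure_distr) (auto simp: sets_N intro!: arg_cong[where f="emeasure (N H)"])
    also have "\<dots> = ennreal (r J B)"
      using B H J by (subst emeasure_N) (auto simp: r_sum)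
    also have "\<dots> = emeasure (N J) {B}"
      using B H J by (subst emeasure_N) (auto dest: finite_subset)
    finally show "emeasure (distr (N H) (count_space (Pow J)) (\<lambda>B. B \<inter> J)) {B} = emeasure (N J) {B}" .
  qed (use H J in \<open>auto simp: sets_N dest: finite_subset\<close>)
  interpret polish_projective L P
  proof (intro polish_projective.intro projective_family.intro)
    fix J H assume JH: "J \<subseteq> H" "finite H" "H \<subseteq> L"
    have [measurable]: "(\<lambda>B. B \<inter> J) \<in> N H \<rightarrow>\<^sub>M count_space (Pow J)"
      by (rule measurableI) (auto simp: sets_N)
    have "distr (P H) (Pi\<^sub>M J (\<lambda>_. borel)) (\<lambda>f. restrict f J) =
        distr (N H) (Pi\<^sub>M J (\<lambda>_. borel)) ((\<lambda>f. restrict f J) \<circ> ind H)"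
      unfolding P_def using JH(1) ind_meas by (intro distr_distr) (auto intro: measurable_restrict_subset)
    also have "\<dots> = distr (N H) (Pi\<^sub>M J (\<lambda>_. borel)) (ind J \<circ> (\<lambda>B. B \<inter> J))"
      using JH(1) by (intro distr_cong) (auto simp: ind_def fun_eq_iff)
    also have "\<dots> = distr (distr (N H) (count_space (Pow J)) (\<lambda>B. B \<inter> J)) (Pi\<^sub>M J (\<lambda>_. borel)) (ind J)"
      using ind_meas[of J J] by (intro distr_distr[symmetric]) (auto simp: ind_def space_PiM)
    finally show "P J = distr (P H) (Pi\<^sub>M J (\<lambda>_. borel)) (\<lambda>f. restrict f J)"
      by (simp add: N_restrict JH P_def)
  next
    fix J assume J: "finite J" "J \<subseteq> L"
    have "(\<Sum>B | B \<subseteq> J. r J B) = 1" using r_sum[of J "{}" "{}"] J r_empty by simp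
    then have "emeasure (N J) (space (N J)) = 1"
      using emeasure_N[OF J, of "Pow J"] by (simp add: sets_N Pow_def)
    then have "prob_space (N J)" by (rule prob_spaceI)
    then show "prob_space (P J)" unfolding P_def using ind_meas by (rule prob_space.prob_space_distr)
  qed
  define \<A> where "\<A> = sigma (Pow L) {{T \<in> Pow L. e \<in> T} | e. e \<in> L}"
  have sets_A: "sets \<A> = sigma_sets (Pow L) {{T \<in> Pow L. e \<in> T} | e. e \<in> L}" "space \<A> = Pow L"
    unfolding \<A>_def by (rule sets_measure_of space_measure_of; blast)+
  define \<phi> where "\<phi> f = {e \<in> L. f e = (1::real)}" for f
  have phi: "\<phi> \<in> lim \<rightarrow>\<^sub>M \<A>"
    unfolding \<A>_def
  proof (rule measurable_measure_of)
    fix X assume "X \<in> {{T \<in> Pow L. e \<in> T} | e. e \<in> L}"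
    then obtain e where e: "e \<in> L" "X = {T \<in> Pow L. e \<in> T}" by auto
    then have "\<phi> -` X \<inter> space lim = (\<lambda>f. f e) -` {1} \<inter> space (Pi\<^sub>M L (\<lambda>_. borel))"
      by (auto simp: \<phi>_def)
    also have "\<dots> \<in> sets lim"
      using measurable_sets[OF measurable_component_singleton[OF e(1), of "\<lambda>_. borel"], of "{1 :: real}"]
      by simp
    finally show "\<phi> -` X \<inter> space lim \<in> sets lim" .
  qed (auto simp: \<phi>_def)
  show ?thesis
  proof (intro exI[of _ "distr lim \<A> \<phi>"] conjI allI impI)
    show "prob_space (distr lim \<A> \<phi>)" using phi by (rule P.prob_space_distr)
    fix A assume A: "A \<subseteq> L" "finite A"
    have mA: "{T \<in> Pow L. A \<subseteq> T} \<in> sets \<A>"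
      unfolding sets_A using A by (rule superset_event_measurable)
    have X: "(\<Pi>\<^sub>E e\<in>A. {1 :: real}) \<in> sets (Pi\<^sub>M A (\<lambda>_. borel))"
      (is "?X \<in> _") using A by (intro sets_PiM_I_finite) auto
    have "measure (distr lim \<A> \<phi>) {T \<in> space (distr lim \<A> \<phi>). A \<subseteq> T} =
        measure lim (\<phi> -` {T \<in> Pow L. A \<subseteq> T} \<inter> space lim)"
      using mA phi by (simp add: sets_A measure_distr)
    also have "\<phi> -` {T \<in> Pow L. A \<subseteq> T} \<inter> space lim = prod_emb L (\<lambda>_. borel) A ?X"
      unfolding prod_emb_def vimage_def mem_Collect_eq restrict_PiE_iff
      using A by (auto simp: \<phi>_def space_PiM)
    also have "measure lim \<dots> = measure (P A) ?X"
      using A X by (rule measure_lim_emb)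
    also have "\<dots> = measure (N A) (ind A -` ?X \<inter> space (N A))"
      unfolding P_def using ind_meas X by (rule measure_distr)
    also have "ind A -` ?X \<inter> space (N A) = {A}"
      unfolding ind_def vimage_def restrict_PiE_iff by (auto simp: sets_N)
    also have "measure (N A) {A} = r A A"
      using A r_nonneg[of A A] emeasure_N[of A "{A}"] by (simp add: measure_def)
    finally have "measure (distr lim \<A> \<phi>) {T \<in> space (distr lim \<A> \<phi>). A \<subseteq> T} = r A A" .
    moreover have "{T \<in> space (M n). T \<inter> A = A} = {T \<in> space (M n). A \<subseteq> T}" for n by auto
    ultimately show "(\<lambda>n. measure (M n) {T \<in> space (M n). A \<subseteq> T}) \<longlonglongrightarrow>
        measure (distr lim \<A> \<phi>) {T \<in> space (distr lim \<A> \<phi>). A \<subseteq> T}"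
      using r[of A A] A by simp
  qed (simp add: \<A>_def)
qed

lemma random_subset_law_unique:
  assumes P: "prob_space P" "sets P = sets (sigma (Pow L) {{T \<in> Pow L. e \<in> T} | e. e \<in> L})"
    and Q: "prob_space Q" "sets Q = sets (sigma (Pow L) {{T \<in> Pow L. e \<in> T} | e. e \<in> L})"
    and eq: "\<And>A. A \<subseteq> L \<Longrightarrow> finite A \<Longrightarrow>
      measure P {T \<in> space P. A \<subseteq> T} = measure Q {T \<in> space Q. A \<subseteq> T}"
  shows "P = Q"
proof -
  let ?G = "{{T \<in> Pow L. e \<in> T} | e. e \<in> L}"
  let ?C = "{{T \<in> Pow L. A \<subseteq> T} | A. A \<subseteq> L \<and> finite A}"
  interpret P: prob_space P by fact
  interpret Q: prob_space Q by fact
  have space: "space P = Pow L" "space Q = Pow L"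
    using P(2)[THEN sets_eq_imp_space_eq] Q(2)[THEN sets_eq_imp_space_eq]
    by (simp_all add: space_measure_of_conv)
  have G: "sets (sigma (Pow L) ?G) = sigma_sets (Pow L) ?G" by (rule sets_measure_of) auto
  have GC: "sigma_sets (Pow L) ?G = sigma_sets (Pow L) ?C"
  proof (rule sigma_sets_eqI)
    fix X assume "X \<in> ?G"
    then obtain e where "e \<in> L" "X = {T \<in> Pow L. {e} \<subseteq> T}" by auto
    then show "X \<in> sigma_sets (Pow L) ?C" by (intro sigma_sets.Basic) blast
  next
    fix X assume "X \<in> ?C"
    then obtain A where A: "A \<subseteq> L" "finite A" "X = {T \<in> Pow L. A \<subseteq> T}" by auto
    show "X \<in> sigma_sets (Pow L) ?G"
      unfolding A(3) using A(1,2) by (rule superset_event_measurable)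
  qed
  show ?thesis
  proof (rule measure_eqI_generator_eq[where E="?C" and \<Omega>="Pow L" and A="\<lambda>_. Pow L"])
    show "Int_stable ?C"
    proof (rule Int_stableI)
      fix X Y assume "X \<in> ?C" "Y \<in> ?C"
      then obtain A B where "A \<subseteq> L" "finite A" "X = {T \<in> Pow L. A \<subseteq> T}"
        "B \<subseteq> L" "finite B" "Y = {T \<in> Pow L. B \<subseteq> T}" by auto
      then show "X \<inter> Y \<in> ?C" by (intro CollectI exI[of _ "A \<union> B"]) auto
    qed
    show "emeasure P X = emeasure Q X" if "X \<in> ?C" for X
      using that eq by (auto simp: space P.emeasure_eq_measure Q.emeasure_eq_measure)
  qed (use P(2) Q(2) G GC in \<open>auto simp: P.emeasure_eq_measure\<close>)
qed

section \<open>Relabelling vertices and counting tree edges\<close>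

lemma linked_image:
  assumes "linked T x y"
  shows "linked ((`) \<phi> ` T) (\<phi> x) (\<phi> y)"
  using assms
proof (induction rule: linked_induct)
  case (step y z)
  have "{\<phi> y, \<phi> z} \<in> (`) \<phi> ` T" using step.hyps(2) by (auto intro: rev_image_eqI)
  with step.IH show ?case by (blast intro: linked_trans linked_edge)
qed simp

lemma linked_image_iff:
  assumes "bij \<phi>"
  shows "linked ((`) \<phi> ` T) (\<phi> x) (\<phi> y) \<longleftrightarrow> linked T x y"
proof
  assume "linked ((`) \<phi> ` T) (\<phi> x) (\<phi> y)"
  from linked_image[OF this, of "inv \<phi>"] show "linked T x y"
    using assms by (simp add: bij_is_inj image_image)
qed (rule linked_image)

lemma forest_image:
  assumes "bij \<phi>" "forest T"
  shows "forest ((`) \<phi> ` T)"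
  unfolding forest_def
proof (intro allI impI)
  fix u v assume uv: "{u, v} \<in> (`) \<phi> ` T"
  define x y where "x = inv \<phi> u" and "y = inv \<phi> v"
  have u: "u = \<phi> x" "v = \<phi> y"
    using assms(1) by (simp_all add: x_def y_def bij_is_surj surj_f_inv_f)
  have inj: "inj ((`) \<phi>)" using assms(1) by (metis bij_is_inj inj_image_eq_iff injI)
  have eq: "{u, v} = \<phi> ` {x, y}" using u by simp
  have "{x, y} \<in> T" using uv unfolding eq inj_image_mem_iff[OF inj] .
  moreover have "(`) \<phi> ` T - {{u, v}} = (`) \<phi> ` (T - {{x, y}})"
    unfolding eq using inj by (simp add: image_set_diff)
  ultimately show "\<not> linked ((`) \<phi> ` T - {{u, v}}) u v"
    using assms by (simp add: u linked_image_iff forest_def)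
qed

lemma finite_graph_image:
  assumes "bij \<phi>" "finite_graph V E"
  shows "finite_graph (\<phi> ` V) ((`) \<phi> ` E)"
proof -
  interpret finite_graph V E by fact
  have "card (\<phi> ` f) = card f" for f
    using assms(1) by (intro card_image) (meson bij_is_inj inj_on_subset subset_UNIV)
  then show ?thesis using edge finite_V by unfold_locales auto
qed

lemma connected_on_iff_linked: "connected_on V T \<longleftrightarrow> (\<forall>u\<in>V. \<forall>v\<in>V. linked T u v)"
  by (simp add: connected_on_def linked_def)

lemma connected_on_image: "connected_on V E \<Longrightarrow> connected_on (\<phi> ` V) ((`) \<phi> ` E)"
  by (auto simp: connected_on_iff_linked intro: linked_image)

lemma spanning_tree_image:
  assumes "bij \<phi>" "finite_graph V E" "T \<in> spanning_trees V E"
  shows "(`) \<phi> ` T \<in> spanning_trees (\<phi> ` V) ((`) \<phi> ` E)"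
proof -
  interpret G: finite_graph V E by fact
  interpret H: finite_graph "\<phi> ` V" "(`) \<phi> ` E" by (rule finite_graph_image) fact+
  have T: "T \<subseteq> E" "\<And>u v. u \<in> V \<Longrightarrow> v \<in> V \<Longrightarrow> linked T u v" "forest T"
    using assms(3) by (auto simp: G.mem_trees)
  show ?thesis
    unfolding H.mem_trees
  proof (intro conjI ballI)
    fix u v assume "u \<in> \<phi> ` V" "v \<in> \<phi> ` V"
    then show "linked ((`) \<phi> ` T) u v" using linked_image[OF T(2)] by blast
  qed (use T forest_image[OF assms(1)] in auto)
qed

text \<open>Relabelling the vertices maps spanning trees to spanning trees and transports the weights.\<close>

lemma tree_prob_image:
  assumes \<phi>: "bij \<phi>" and G: "finite_graph V E"
  shows "tree_prob w (\<phi> ` V) ((`) \<phi> ` E) ((`) \<phi> ` A) = tree_prob (\<lambda>f. w (\<phi> ` f)) V E A"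
proof -
  have inj: "inj ((`) \<phi>)" using \<phi> by (metis bij_is_inj inj_image_eq_iff injI)
  have inv_image: "(`) (inv \<phi>) ` (`) \<phi> ` S = S" "inv \<phi> ` \<phi> ` U = U" for S U
    using \<phi> by (simp_all add: image_image bij_is_inj)
  have image_inv: "(`) \<phi> ` (`) (inv \<phi>) ` S = S" for S
    using \<phi> by (simp add: image_image bij_is_surj surj_f_inv_f)
  have "(\<Sum>T | T \<in> spanning_trees (\<phi> ` V) ((`) \<phi> ` E) \<and> (`) \<phi> ` A \<subseteq> T. prod w T) =
      (\<Sum>T | T \<in> spanning_trees V E \<and> A \<subseteq> T. prod (\<lambda>f. w (\<phi> ` f)) T)" for A
  proof (rule sum.reindex_bij_witness[where i="(`) ((`) \<phi>)" and j="(`) ((`) (inv \<phi>))"])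
    fix T assume T: "T \<in> {T \<in> spanning_trees (\<phi> ` V) ((`) \<phi> ` E). (`) \<phi> ` A \<subseteq> T}"
    show "(`) \<phi> ` (`) (inv \<phi>) ` T = T" by (rule image_inv)
    have "(`) (inv \<phi>) ` T \<in> spanning_trees (inv \<phi> ` \<phi> ` V) ((`) (inv \<phi>) ` (`) \<phi> ` E)"
      using \<phi> G T by (intro spanning_tree_image finite_graph_image) (auto simp: bij_imp_bij_inv)
    moreover have "A \<subseteq> (`) (inv \<phi>) ` T"
      using T image_mono[of "(`) \<phi> ` A" T "(`) (inv \<phi>)"] by (simp add: inv_image)
    ultimately show "(`) (inv \<phi>) ` T \<in> {T \<in> spanning_trees V E. A \<subseteq> T}" by (simp add: inv_image)
    have "prod w ((`) \<phi> ` (`) (inv \<phi>) ` T) = prod (\<lambda>f. w (\<phi> ` f)) ((`) (inv \<phi>) ` T)"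
      using inj by (subst prod.reindex) (auto intro: inj_on_subset)
    then show "prod (\<lambda>f. w (\<phi> ` f)) ((`) (inv \<phi>) ` T) = prod w T" by (simp add: image_inv)
  next
    fix T assume T: "T \<in> {T \<in> spanning_trees V E. A \<subseteq> T}"
    show "(`) (inv \<phi>) ` (`) \<phi> ` T = T" by (rule inv_image)
    show "(`) \<phi> ` T \<in> {T \<in> spanning_trees (\<phi> ` V) ((`) \<phi> ` E). (`) \<phi> ` A \<subseteq> T}"
      using spanning_tree_image[OF \<phi> G] T by auto
  qed
  note sums = this[of A] this[of "{}", unfolded image_empty, simplified empty_subsetI simp_thms Collect_mem_eq]
  show ?thesis unfolding tree_prob_def sums ..
qed

lemma (in finite_graph) sum_tree_prob_edges:
  fixes w :: "'v set \<Rightarrow> real"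
  assumes "finite B"
  shows "(\<Sum>f\<in>B. tree_prob w V E {f}) =
    (\<Sum>T\<in>spanning_trees V E. prod w T * card (B \<inter> T)) / (\<Sum>T\<in>spanning_trees V E. prod w T)"
proof -
  have "(\<Sum>f\<in>B. \<Sum>T | T \<in> spanning_trees V E \<and> f \<in> T. prod w T) =
      (\<Sum>T\<in>spanning_trees V E. \<Sum>f | f \<in> B \<and> f \<in> T. prod w T)"
    by (rule sum.swap_restrict) (use assms finite_trees in auto)
  also have "\<dots> = (\<Sum>T\<in>spanning_trees V E. prod w T * card (B \<inter> T))"
    by (simp add: Int_def mult.commute)
  finally show ?thesis by (simp add: tree_prob_def flip: sum_divide_distrib)
qed

text \<open>The sum is the expected number of edges of \<open>B\<close> in the random tree, and a spanning tree has fewer edges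
  than vertices.\<close>

lemma (in finite_graph) sum_tree_prob_le:
  fixes w :: "'v set \<Rightarrow> real"
  assumes "connected_on V E" "\<And>f. w f > 0" "finite B" "V \<noteq> {}"
  shows "(\<Sum>f\<in>B. tree_prob w V E {f}) \<le> real (card V) - 1"
proof -
  have pos: "(\<Sum>T\<in>spanning_trees V E. prod w T) > 0"
    using assms(1,2) by (rule partition_function_pos)
  have "card (B \<inter> T) + 1 \<le> card V" if "T \<in> spanning_trees V E" for T
  proof -
    have "finite T" using that finite_E by (auto simp: mem_trees dest: finite_subset)
    then have "card (B \<inter> T) \<le> card T" by (intro card_mono) auto
    also have "card T < card V"
      using that edge by (intro forest_card_less finite_V assms) (auto simp: mem_trees)
    finally show ?thesis by simp
  qed
  then have "real (card (B \<inter> T)) \<le> real (card V) - 1" if "T \<in> spanning_trees V E" for T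
    using that by fastforce
  then have "(\<Sum>T\<in>spanning_trees V E. prod w T * card (B \<inter> T)) \<le>
      (\<Sum>T\<in>spanning_trees V E. prod w T * (real (card V) - 1))"
    using assms(2) by (intro sum_mono mult_left_mono prod_nonneg) (auto simp: less_imp_le)
  then show ?thesis
    using pos by (simp add: sum_tree_prob_edges assms(3) divide_le_eq mult.commute flip: sum_distrib_right)
qed

text \<open>In a spanning tree every vertex of \<open>U\<close> is connected to the outside of \<open>U\<close>, so already the edges
  touching \<open>U\<close> are at least as many as the vertices of \<open>U\<close>.\<close>

lemma (in finite_graph) sum_tree_prob_touching_ge:
  fixes w :: "'v set \<Rightarrow> real"
  assumes "connected_on V E" "\<And>f. w f > 0" "finite B" "U \<subset> V"
    and B: "\<And>f. f \<in> E \<Longrightarrow> f \<inter> U \<noteq> {} \<Longrightarrow> f \<in> B"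
  shows "(\<Sum>f\<in>B. tree_prob w V E {f}) \<ge> card U"
proof -
  have pos: "(\<Sum>T\<in>spanning_trees V E. prod w T) > 0"
    using assms(1,2) by (rule partition_function_pos)
  obtain v where v: "v \<in> V" "v \<notin> U" using assms(4) by auto
  have "card U \<le> card (B \<inter> T)" if T: "T \<in> spanning_trees V E" for T
  proof -
    have "finite T" using T finite_E by (auto simp: mem_trees dest: finite_subset)
    moreover have "\<exists>v. v \<notin> U \<and> linked T u v" if "u \<in> U" for u
      using T v that assms(4) by (intro exI[of _ v]) (auto simp: mem_trees)
    ultimately have "card U \<le> card {f \<in> T. f \<inter> U \<noteq> {}}"
      using assms(4) finite_V by (intro card_le_edges_touching) (auto dest: finite_subset)
    also have "\<dots> \<le> card (B \<inter> T)"
      using B T assms(3) by (intro card_mono) (auto simp: mem_trees)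
    finally show ?thesis .
  qed
  then have "(\<Sum>T\<in>spanning_trees V E. prod w T * card U) \<le>
      (\<Sum>T\<in>spanning_trees V E. prod w T * card (B \<inter> T))"
    using assms(2) by (intro sum_mono mult_left_mono prod_nonneg) (auto simp: less_imp_le)
  then show ?thesis
    using pos by (simp add: sum_tree_prob_edges assms(3) le_divide_eq mult.commute flip: sum_distrib_right)
qed

lemma tree_prob_bounds:
  assumes "finite_graph V E" "\<And>f. w f > 0"
  shows "0 \<le> tree_prob w V E A" "tree_prob w V E A \<le> 1"
proof -
  interpret finite_graph V E by fact
  have w: "0 \<le> prod w T" for T using assms(2) by (intro prod_nonneg) (simp add: less_imp_le)
  then show "0 \<le> tree_prob w V E A" by (auto simp: tree_prob_def intro!: divide_nonneg_nonneg sum_nonneg)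
  have "(\<Sum>T | T \<in> spanning_trees V E \<and> A \<subseteq> T. prod w T) \<le> (\<Sum>T\<in>spanning_trees V E. prod w T)"
    using w finite_trees by (intro sum_mono2) auto
  then show "tree_prob w V E A \<le> 1"
    using w by (auto simp: tree_prob_def intro!: divide_le_eq_1[THEN iffD2] sum_nonneg
        simp: less_le)
qed

section \<open>Lattice boxes\<close>

lemma lattice_edge_card: "f \<in> lattice_edges \<Longrightarrow> card f = 2"
proof -
  assume "f \<in> lattice_edges"
  then obtain u v where uv: "f = {u, v}" "(\<Sum>i\<in>UNIV. \<bar>u $ i - v $ i\<bar>) = 1"
    by (auto simp: lattice_edges_def)
  then have "u \<noteq> v" by auto
  with uv show ?thesis by simp
qed

lemma finite_lattice_box: "finite (lattice_box n :: (int ^ 'd::finite) set)"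
proof (rule finite_subset)
  show "(lattice_box n :: (int ^ 'd) set) \<subseteq> vec_lambda ` (\<Pi>\<^sub>E i\<in>UNIV. {- int n..int n})"
  proof
    fix x :: "int ^ 'd" assume "x \<in> lattice_box n"
    then show "x \<in> vec_lambda ` (\<Pi>\<^sub>E i\<in>UNIV. {- int n..int n})"
      by (intro image_eqI[of _ _ "vec_nth x"]) (auto simp: lattice_box_def abs_le_iff minus_le_iff)
  qed
qed (simp add: finite_PiE)

lemma finite_graph_box: "finite_graph (lattice_box n) (box_edges n)"
  by unfold_locales (auto simp: finite_lattice_box box_edges_def lattice_edge_card)

lemma lattice_box_mono: "m \<le> n \<Longrightarrow> lattice_box m \<subseteq> lattice_box n"
  by (auto simp: lattice_box_def) (meson of_nat_mono order_trans)

lemma box_edges_mono: "m \<le> n \<Longrightarrow> box_edges m \<subseteq> box_edges n"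
  using lattice_box_mono by (fastforce simp: box_edges_def)

lemma unit_step_lattice_edge: "{x, x + axis i 1} \<in> (lattice_edges :: (int ^ 'd::finite) set set)"
proof -
  have "(\<Sum>j\<in>UNIV. \<bar>x $ j - (x + axis i 1) $ j\<bar>) = (\<Sum>j\<in>UNIV. if j = i then 1 else 0)"
    by (rule sum.cong) (auto simp: axis_def)
  then have "(\<Sum>j\<in>UNIV. \<bar>x $ j - (x + axis i 1) $ j\<bar>) = 1" by simp
  then show ?thesis unfolding lattice_edges_def by blast
qed

text \<open>Stepping towards the origin in a nonzero coordinate stays in the box and decreases the \<open>l\<^sup>1\<close>-norm.\<close>

lemma lattice_box_connected: "connected_on (lattice_box n :: (int ^ 'd::finite) set) (box_edges n)"
proof -
  have *: "linked (box_edges n) x 0" if "x \<in> lattice_box n" for x :: "int ^ 'd"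
    using that
  proof (induction "nat (\<Sum>i\<in>UNIV. \<bar>x $ i\<bar>)" arbitrary: x rule: less_induct)
    case less
    show ?case
    proof (cases "x = 0")
      case False
      then obtain i where i: "x $ i \<noteq> 0" by (auto simp: vec_eq_iff)
      define y where "y = x - axis i (sgn (x $ i))"
      have y: "y $ j = (if j = i then x $ i - sgn (x $ i) else x $ j)" for j
        by (auto simp: y_def axis_def)
      have abs_i: "\<bar>x $ i - sgn (x $ i)\<bar> = \<bar>x $ i\<bar> - 1" using i by (auto simp: sgn_if)
      then have le: "\<bar>y $ j\<bar> \<le> \<bar>x $ j\<bar>" for j by (simp add: y)
      then have box: "y \<in> lattice_box n"
        using less.prems by (auto simp: lattice_box_def intro: order_trans)
      have "(\<Sum>j\<in>UNIV. \<bar>y $ j\<bar>) < (\<Sum>j\<in>UNIV. \<bar>x $ j\<bar>)"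
        using le abs_i by (intro sum_strict_mono_ex1) (auto simp: y intro!: exI[of _ i])
      moreover have "0 \<le> (\<Sum>j\<in>UNIV. \<bar>y $ j\<bar>)" by (simp add: sum_nonneg)
      ultimately have "nat (\<Sum>j\<in>UNIV. \<bar>y $ j\<bar>) < nat (\<Sum>j\<in>UNIV. \<bar>x $ j\<bar>)" by linarith
      then have "linked (box_edges n) y 0" using box by (rule less.hyps)
      moreover have "{x, y} \<in> box_edges n"
      proof -
        have "(\<Sum>j\<in>UNIV. \<bar>x $ j - y $ j\<bar>) = (\<Sum>j\<in>UNIV. if j = i then 1 else 0)"
          using i by (intro sum.cong) (auto simp: y sgn_if)
        then have "(\<Sum>j\<in>UNIV. \<bar>x $ j - y $ j\<bar>) = 1" by simp
        then have "{x, y} \<in> lattice_edges" unfolding lattice_edges_def by blast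
        then show ?thesis using box less.prems by (simp add: box_edges_def)
      qed
      ultimately show ?thesis by (blast intro: linked_trans linked_edge)
    qed simp
  qed
  then show ?thesis
    unfolding connected_on_iff_linked by (blast intro: linked_trans linked_sym)
qed

lemma finite_subset_lattice_box:
  assumes "finite (S :: (int ^ 'd::finite) set)"
  shows "\<exists>n. S \<subseteq> lattice_box n"
proof -
  define n where "n = nat (\<Sum>x\<in>S. \<Sum>i\<in>UNIV. \<bar>x $ i\<bar>)"
  have "\<bar>x $ i\<bar> \<le> int n" if "x \<in> S" for x i
  proof -
    have "\<bar>x $ i\<bar> \<le> (\<Sum>i\<in>UNIV. \<bar>x $ i\<bar>)" by (rule member_le_sum) auto
    also have "\<dots> \<le> (\<Sum>x\<in>S. \<Sum>i\<in>UNIV. \<bar>x $ i\<bar>)"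
      using assms that by (intro member_le_sum) (auto simp: sum_nonneg)
    finally show ?thesis by (simp add: n_def sum_nonneg)
  qed
  then show ?thesis by (auto simp: lattice_box_def)
qed

lemma finite_subset_box_edges:
  assumes "finite A" "A \<subseteq> (lattice_edges :: (int ^ 'd::finite) set set)"
  shows "\<exists>n. A \<subseteq> box_edges n"
proof -
  have "finite (\<Union>A)"
    using assms lattice_edge_card by (metis card.infinite finite_Union subsetD zero_neq_numeral)
  from finite_subset_lattice_box[OF this] show ?thesis using assms by (auto simp: box_edges_def)
qed

section \<open>The infinite-volume edge probabilities\<close>

abbreviation edge_weight :: "real \<Rightarrow> ('v set \<Rightarrow> real) \<Rightarrow> 'v set \<Rightarrow> real" where
  "edge_weight \<beta> \<omega> \<equiv> \<lambda>e. exp (- \<beta> * \<omega> e)"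

definition box_prob :: "real \<Rightarrow> ((int ^ 'd::finite) set \<Rightarrow> real) \<Rightarrow> nat \<Rightarrow> (int ^ 'd) set set \<Rightarrow> real" where
  "box_prob \<beta> \<omega> n = tree_prob (edge_weight \<beta> \<omega>) (lattice_box n) (box_edges n)"

lemma free_tree_measure:
  fixes \<omega> :: "(int ^ 'd::finite) set \<Rightarrow> real" and \<beta> :: real
  defines "M \<equiv> free_tree_measure \<beta> \<omega>"
  shows "prob_space (M n)" "sets (M n) = Pow (space (M n))"
    and "measure (M n) {T \<in> space (M n). A \<subseteq> T} = box_prob \<beta> \<omega> n A"
proof -
  define S where "S = spanning_trees (lattice_box n :: (int ^ 'd) set) (box_edges n)"
  define Z where "Z = (\<Sum>T\<in>S. prod (edge_weight \<beta> \<omega>) T)"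
  interpret finite_graph "lattice_box n :: (int ^ 'd) set" "box_edges n" by (rule finite_graph_box)
  have S: "finite S" by (simp add: S_def finite_trees)
  have Z: "Z > 0" unfolding Z_def S_def by (rule partition_function_pos[OF lattice_box_connected]) simp
  have M: "M n = point_measure S (\<lambda>T. ennreal (prod (edge_weight \<beta> \<omega>) T / Z))"
    unfolding M_def free_tree_measure_def tree_weight_def Let_def S_def Z_def ..
  show sets: "sets (M n) = Pow (space (M n))" by (simp add: M sets_point_measure space_point_measure)
  have space: "space (M n) = S" by (simp add: M space_point_measure)
  have em: "emeasure (M n) X = ennreal ((\<Sum>T\<in>X. prod (edge_weight \<beta> \<omega>) T) / Z)" if "X \<subseteq> S" for X
    unfolding M emeasure_point_measure_finite[OF S that]
    using Z by (simp add: sum_ennreal prod_nonneg sum_divide_distrib)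
  show "prob_space (M n)"
    by (rule prob_spaceI) (unfold space em[OF order_refl] Z_def[symmetric], use Z in simp)
  have "0 \<le> (\<Sum>T | T \<in> S \<and> A \<subseteq> T. prod (edge_weight \<beta> \<omega>) T) / Z"
    using Z by (intro divide_nonneg_pos sum_nonneg prod_nonneg) auto
  then show "measure (M n) {T \<in> space (M n). A \<subseteq> T} = box_prob \<beta> \<omega> n A"
    using em[of "{T \<in> S. A \<subseteq> T}"]
    unfolding box_prob_def tree_prob_def S_def[symmetric] Z_def[symmetric]
    by (simp add: measure_def space)
qed

lemma box_prob_le_subgraph:
  assumes "finite_graph V E" "connected_on V E" "E \<subseteq> box_edges n" "A \<subseteq> E"
  shows "box_prob \<beta> \<omega> n A \<le> tree_prob (edge_weight \<beta> \<omega>) V E A"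
  unfolding box_prob_def
  using assms by (intro tree_prob_antimono finite_graph_box lattice_box_connected) auto

lemma box_prob_convergent:
  assumes "finite A" "A \<subseteq> lattice_edges"
  shows "convergent (\<lambda>n. box_prob \<beta> \<omega> n A)"
proof -
  obtain N where N: "A \<subseteq> box_edges N" using finite_subset_box_edges[OF assms] by blast
  have "decseq (\<lambda>n. box_prob \<beta> \<omega> (n + N) A)"
  proof (rule decseq_SucI)
    fix n
    have "box_prob \<beta> \<omega> (Suc n + N) A \<le> tree_prob (edge_weight \<beta> \<omega>) (lattice_box (n + N)) (box_edges (n + N)) A"
      using N box_edges_mono[of "N" "n + N"]
      by (intro box_prob_le_subgraph finite_graph_box lattice_box_connected box_edges_mono) auto
    then show "box_prob \<beta> \<omega> (Suc n + N) A \<le> box_prob \<beta> \<omega> (n + N) A" by (simp add: box_prob_def)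
  qed
  moreover have "\<forall>n. 0 \<le> box_prob \<beta> \<omega> (n + N) A"
    by (simp add: box_prob_def tree_prob_bounds finite_graph_box)
  ultimately have "convergent (\<lambda>n. box_prob \<beta> \<omega> (n + N) A)"
    by (metis convergentI decseq_convergent)
  then show ?thesis
    using convergent_ignore_initial_segment[of "\<lambda>n. box_prob \<beta> \<omega> n A" N] by blast
qed

text \<open>The infinite-volume limit exists and is unique for every environment, so \<open>infinite_tree_measure\<close> denotes it.\<close>

lemma edge_prob_limit:
  assumes "e \<in> lattice_edges"
  shows "(\<lambda>n. box_prob \<beta> \<omega> n {e}) \<longlonglongrightarrow> edge_prob \<beta> \<omega> e"
proof -
  have ex: "\<exists>P. is_infinite_volume_limit \<beta> \<omega> P"
    unfolding is_infinite_volume_limit_def subgraph_algebra_def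
    by (rule random_subset_limit_exists) (simp_all add: free_tree_measure box_prob_convergent)
  have "P = Q" if "is_infinite_volume_limit \<beta> \<omega> P" "is_infinite_volume_limit \<beta> \<omega> Q" for P Q
  proof (rule random_subset_law_unique[where L=lattice_edges])
    fix A :: "(int ^ 'a) set set" assume "A \<subseteq> lattice_edges" "finite A"
    then show "measure P {T \<in> space P. A \<subseteq> T} = measure Q {T \<in> space Q. A \<subseteq> T}"
      using that unfolding is_infinite_volume_limit_def by (metis (no_types, lifting) LIMSEQ_unique)
  qed (use that in \<open>auto simp: is_infinite_volume_limit_def subgraph_algebra_def\<close>)
  then have "is_infinite_volume_limit \<beta> \<omega> (infinite_tree_measure \<beta> \<omega>)"
    unfolding infinite_tree_measure_def using ex by (metis theI)
  then show ?thesis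
    using assms by (auto simp: is_infinite_volume_limit_def edge_prob_def free_tree_measure(3)
        dest!: spec[of _ "{e}"])
qed

text \<open>Any finite connected subgraph, not only a centred box, bounds the limit from above; this makes the
  limit insensitive to translations.\<close>

lemma edge_prob_le_subgraph:
  assumes "finite_graph V E" "connected_on V E" "E \<subseteq> lattice_edges" "e \<in> E"
  shows "edge_prob \<beta> \<omega> e \<le> tree_prob (edge_weight \<beta> \<omega>) V E {e}"
proof -
  have "finite E" using assms(1) by (rule finite_graph.finite_E)
  then obtain N where N: "E \<subseteq> box_edges N" using finite_subset_box_edges assms(3) by blast
  have "\<exists>N. \<forall>n\<ge>N. box_prob \<beta> \<omega> n {e} \<le> tree_prob (edge_weight \<beta> \<omega>) V E {e}"
    using N box_edges_mono assms by (intro exI[of _ N] allI impI box_prob_le_subgraph) blast+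
  moreover have "e \<in> lattice_edges" using assms by blast
  ultimately show ?thesis by (intro LIMSEQ_le_const2[OF edge_prob_limit])
qed

lemma edge_prob_bounds:
  assumes "e \<in> lattice_edges"
  shows "0 \<le> edge_prob \<beta> \<omega> e" "edge_prob \<beta> \<omega> e \<le> 1"
  using LIMSEQ_le_const[OF edge_prob_limit[OF assms]] LIMSEQ_le_const2[OF edge_prob_limit[OF assms]]
  by (auto simp: box_prob_def tree_prob_bounds finite_graph_box)

lemma sum_edge_prob_le:
  fixes \<omega> :: "(int ^ 'd::finite) set \<Rightarrow> real"
  shows "(\<Sum>e\<in>box_edges n. edge_prob \<beta> \<omega> e) \<le> real (card (lattice_box n :: (int ^ 'd) set)) - 1"
proof -
  interpret finite_graph "lattice_box n :: (int ^ 'd) set" "box_edges n" by (rule finite_graph_box)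
  have "(\<Sum>e\<in>box_edges n. edge_prob \<beta> \<omega> e) \<le>
      (\<Sum>e\<in>box_edges n. tree_prob (edge_weight \<beta> \<omega>) (lattice_box n) (box_edges n) {e})"
    by (intro sum_mono edge_prob_le_subgraph finite_graph_box lattice_box_connected)
      (auto simp: box_edges_def)
  also have "\<dots> \<le> real (card (lattice_box n :: (int ^ 'd::finite) set)) - 1"
  proof (rule sum_tree_prob_le[OF lattice_box_connected _ finite_E])
    have "0 \<in> (lattice_box n :: (int ^ 'd) set)" by (simp add: lattice_box_def)
    then show "(lattice_box n :: (int ^ 'd) set) \<noteq> {}" by blast
  qed simp
  finally show ?thesis .
qed

text \<open>An edge touching the box of radius \<open>n\<close> lies in the box of radius \<open>n + 1\<close>.  The bound holds in every
  larger finite box, and passes to the limit.\<close>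

lemma sum_edge_prob_ge:
  fixes \<omega> :: "(int ^ 'd::finite) set \<Rightarrow> real"
  shows "real (card (lattice_box n :: (int ^ 'd) set)) \<le> (\<Sum>e\<in>box_edges (Suc n). edge_prob \<beta> \<omega> e)"
proof (rule LIMSEQ_le_const)
  show "(\<lambda>m. \<Sum>e\<in>box_edges (Suc n). box_prob \<beta> \<omega> m {e}) \<longlonglongrightarrow> (\<Sum>e\<in>box_edges (Suc n). edge_prob \<beta> \<omega> e)"
    by (intro tendsto_sum edge_prob_limit) (auto simp: box_edges_def)
  have "real (card (lattice_box n :: (int ^ 'd) set)) \<le> (\<Sum>e\<in>box_edges (Suc n). box_prob \<beta> \<omega> m {e})"
    if m: "m \<ge> Suc n" for m
    unfolding box_prob_def
  proof (rule finite_graph.sum_tree_prob_touching_ge[OF finite_graph_box lattice_box_connected])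
    show "finite (box_edges (Suc n) :: (int ^ 'd) set set)"
      by (rule finite_graph.finite_E[OF finite_graph_box])
    have "(\<chi> i. int m) \<in> lattice_box m - (lattice_box n :: (int ^ 'd) set)"
      using m by (simp add: lattice_box_def)
    moreover have "lattice_box n \<subseteq> (lattice_box m :: (int ^ 'd) set)"
      using m by (intro lattice_box_mono) simp
    ultimately show "lattice_box n \<subset> (lattice_box m :: (int ^ 'd) set)" by blast
    fix f :: "(int ^ 'd) set" assume f: "f \<in> box_edges m" "f \<inter> lattice_box n \<noteq> {}"
    then obtain u v where uv: "f = {u, v}" "(\<Sum>i\<in>UNIV. \<bar>u $ i - v $ i\<bar>) = 1"
      by (auto simp: box_edges_def lattice_edges_def)
    have d: "\<bar>u $ i - v $ i\<bar> \<le> 1" for i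
      using member_le_sum[of i UNIV "\<lambda>i. \<bar>u $ i - v $ i\<bar>"] uv(2) by simp
    have "u \<in> lattice_box n \<or> v \<in> lattice_box n" using f uv by auto
    then have "\<bar>u $ i\<bar> \<le> int (Suc n) \<and> \<bar>v $ i\<bar> \<le> int (Suc n)" for i
      using d[of i] by (auto simp: lattice_box_def dest!: spec[of _ i])
    then show "f \<in> box_edges (Suc n)" using f uv by (auto simp: box_edges_def lattice_box_def)
  qed simp
  then show "\<exists>N. \<forall>m\<ge>N. real (card (lattice_box n :: (int ^ 'd) set)) \<le> (\<Sum>e\<in>box_edges (Suc n). box_prob \<beta> \<omega> m {e})"
    by blast
qed

section \<open>A strong law under local dependence\<close>

text \<open>Only near pairs contribute to the variance of the sum over \<open>D n\<close>, so it is at most \<open>C * card (D n)\<close>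
  and the squared normalised deviations have expectations of order \<open>1 / n\<^sup>2\<close>.  Their sum over \<open>n\<close> is
  integrable, hence almost surely finite, and its terms tend to zero.\<close>

lemma (in prob_space) strong_law_local_dependence:
  fixes Y :: "'i \<Rightarrow> 'a \<Rightarrow> real" and D :: "nat \<Rightarrow> 'i set" and a :: "nat \<Rightarrow> real"
  assumes Y [measurable]: "\<And>p. Y p \<in> borel_measurable M"
    and bounds: "\<And>p \<omega>. 0 \<le> Y p \<omega>" "\<And>p \<omega>. Y p \<omega> \<le> 1"
    and mean: "\<And>p. expectation (Y p) = m"
    and indep: "\<And>p q. \<not> near p q \<Longrightarrow> expectation (\<lambda>\<omega>. Y p \<omega> * Y q \<omega>) = m * m"
    and D: "\<And>n. finite (D n)" "\<And>n p. p \<in> D n \<Longrightarrow> card {q \<in> D n. near p q} \<le> C"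
    and a: "\<And>n. real n ^ 2 \<le> a n" "\<And>n. real (card (D n)) \<le> K * a n"
  shows "AE \<omega> in M. (\<lambda>n. ((\<Sum>p\<in>D n. Y p \<omega>) - real (card (D n)) * m) / a n) \<longlonglongrightarrow> 0"
proof -
  have int: "integrable M (Y p)" for p
    using bounds by (intro integrable_const_bound[of _ 1]) auto
  have int2: "integrable M (\<lambda>\<omega>. Y p \<omega> * Y q \<omega>)" for p q
    using bounds by (intro integrable_const_bound[of _ 1]) (auto simp: abs_mult intro!: mult_le_one)
  have m: "0 \<le> m" "m \<le> 1"
    unfolding mean[of undefined, symmetric] using bounds
    by (auto intro!: integral_nonneg_AE integral_le_const int)
  define cov where "cov p q = expectation (\<lambda>\<omega>. (Y p \<omega> - m) * (Y q \<omega> - m))" for p q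
  have intc: "integrable M (\<lambda>\<omega>. (Y p \<omega> - m) * (Y q \<omega> - m))" for p q
    using int int2 by (simp add: algebra_simps)
  have cov: "cov p q = expectation (\<lambda>\<omega>. Y p \<omega> * Y q \<omega>) - m * m" for p q
    unfolding cov_def using int int2 mean by (simp add: algebra_simps prob_space)
  have cov_le: "cov p q \<le> of_bool (near p q)" for p q
  proof (cases "near p q")
    case True
    have "cov p q \<le> expectation (\<lambda>\<omega>. Y p \<omega> * Y q \<omega>)" by (simp add: cov)
    also have "\<dots> \<le> 1"
      using bounds by (intro integral_le_const int2) (auto intro!: mult_le_one)
    finally show ?thesis using True by simp
  next
    case False
    then show ?thesis by (simp add: cov indep)
  qed
  define X where "X n \<omega> = (((\<Sum>p\<in>D n. Y p \<omega>) - real (card (D n)) * m) / a n)\<^sup>2" for n \<omega>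
  have [measurable]: "X n \<in> borel_measurable M" for n unfolding X_def by measurable
  have X: "X n \<omega> = (\<Sum>p\<in>D n. \<Sum>q\<in>D n. (Y p \<omega> - m) * (Y q \<omega> - m)) / (a n)\<^sup>2" for n \<omega>
  proof -
    have "(\<Sum>p\<in>D n. Y p \<omega>) - real (card (D n)) * m = (\<Sum>p\<in>D n. Y p \<omega> - m)"
      by (simp add: sum_subtractf)
    then show ?thesis by (simp add: X_def power_divide power2_eq_square sum_product)
  qed
  have intX: "integrable M (X n)" for n
    unfolding X using intc by simp
  have EX: "expectation (X n) \<le> C * K * (1 / real n ^ 2)" if "n > 0" for n
  proof -
    have an: "a n > 0" using a(1)[of n] that by (meson less_le_trans of_nat_0_less_iff zero_less_power)
    have "expectation (X n) = (\<Sum>p\<in>D n. \<Sum>q\<in>D n. cov p q) / (a n)\<^sup>2"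
      unfolding X cov_def using intc by simp
    also have "(\<Sum>p\<in>D n. \<Sum>q\<in>D n. cov p q) \<le> (\<Sum>p\<in>D n. \<Sum>q\<in>D n. of_bool (near p q))"
      by (intro sum_mono cov_le)
    also have "\<dots> = (\<Sum>p\<in>D n. real (card {q \<in> D n. near p q}))"
      using D(1) by (simp add: of_bool_def sum.If_cases Int_def)
    also have "\<dots> \<le> (\<Sum>p\<in>D n. real C)"
      using D(2) by (intro sum_mono) simp
    also have "\<dots> \<le> C * (K * a n)" using a(2)[of n] by (simp add: mult.commute mult_left_mono)
    finally have "expectation (X n) \<le> C * (K * a n) / (a n)\<^sup>2"
      by (simp add: divide_right_mono)
    also have "\<dots> = C * K * (1 / a n)" using an by (simp add: power2_eq_square)
    also have "\<dots> \<le> C * K * (1 / real n ^ 2)"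
    proof (rule mult_left_mono)
      show "1 / a n \<le> 1 / real n ^ 2" using a(1)[of n] that by (intro divide_left_mono) (auto simp: an)
      have "0 \<le> K * a n" using a(2)[of n] by linarith
      then have "0 \<le> K" using an by (simp add: zero_le_mult_iff)
      then show "0 \<le> C * K" by simp
    qed
    finally show ?thesis .
  qed
  have sm: "summable (\<lambda>n. expectation (X n))"
  proof (rule summable_comparison_test)
    have "norm (expectation (X n)) \<le> C * K * (1 / real n ^ 2)" if "n \<ge> 1" for n
    proof -
      have "0 \<le> expectation (X n)" by (intro integral_nonneg_AE) (simp add: X_def)
      then show ?thesis using EX[of n] that by simp
    qed
    then show "\<exists>N. \<forall>n\<ge>N. norm (expectation (X n)) \<le> C * K * (1 / real n ^ 2)" by blast
    show "summable (\<lambda>n. C * K * (1 / real n ^ 2))"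
      using inverse_power_summable[of 2, where 'a=real] by (intro summable_mult) (simp add: inverse_eq_divide)
  qed
  have "(\<integral>\<^sup>+\<omega>. (\<Sum>n. ennreal (X n \<omega>)) \<partial>M) = (\<Sum>n. \<integral>\<^sup>+\<omega>. ennreal (X n \<omega>) \<partial>M)"
    by (rule nn_integral_suminf) measurable
  also have "\<dots> = (\<Sum>n. ennreal (expectation (X n)))"
    by (intro suminf_cong nn_integral_eq_integral intX) (simp add: X_def)
  also have "\<dots> = ennreal (\<Sum>n. expectation (X n))"
    by (intro suminf_ennreal2 sm integral_nonneg_AE) (simp add: X_def)
  finally have "(\<integral>\<^sup>+\<omega>. (\<Sum>n. ennreal (X n \<omega>)) \<partial>M) \<noteq> \<infinity>" by simp
  then have "AE \<omega> in M. (\<Sum>n. ennreal (X n \<omega>)) \<noteq> \<infinity>"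
    by (intro nn_integral_PInf_AE) measurable
  then show ?thesis
  proof eventually_elim
    case (elim \<omega>)
    then have "summable (\<lambda>n. X n \<omega>)"
      by (intro summable_suminf_not_top) (auto simp: X_def)
    then have "(\<lambda>n. X n \<omega>) \<longlonglongrightarrow> 0" by (rule summable_LIMSEQ_zero)
    then have "(\<lambda>n. sqrt (X n \<omega>)) \<longlonglongrightarrow> sqrt 0" by (rule tendsto_real_sqrt)
    then have "(\<lambda>n. \<bar>((\<Sum>p\<in>D n. Y p \<omega>) - real (card (D n)) * m) / a n\<bar>) \<longlonglongrightarrow> 0"
      unfolding X_def real_sqrt_abs by simp
    then show ?case by (rule tendsto_rabs_zero_cancel)
  qed
qed

section \<open>Edges as positions and directions\<close>

text \<open>Every edge is \<open>{x, x + e\<^sub>i}\<close> for exactly one pair \<open>(x, i)\<close>.  These pairs are easier to count and to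
  move around than two-element sets.\<close>

definition axis_edge :: "(int ^ 'd::finite) \<times> 'd \<Rightarrow> (int ^ 'd) set" where
  "axis_edge = (\<lambda>(x, i). {x, x + axis i 1})"

definition box_slots :: "nat \<Rightarrow> ((int ^ 'd::finite) \<times> 'd) set" where
  "box_slots n = {(x, i). x \<in> lattice_box n \<and> x $ i < int n}"

lemma axis_edge_lattice: "axis_edge p \<in> lattice_edges"
  by (cases p) (simp add: axis_edge_def unit_step_lattice_edge)

lemma inj_axis_edge: "inj (axis_edge :: (int ^ 'd::finite) \<times> 'd \<Rightarrow> _)"
proof (rule injI, clarify)
  fix x y :: "int ^ 'd" and i j :: 'd
  assume "axis_edge (x, i) = axis_edge (y, j)"
  then consider "x = y" "x + axis i 1 = y + axis j 1" | "x = y + axis j 1" "y = x + axis i 1"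
    unfolding axis_edge_def prod.case doubleton_eq_iff by metis
  then show "x = y \<and> i = j"
  proof cases
    case 1
    then show ?thesis by (simp add: axis_eq_axis)
  next
    case 2
    then have "x $ i = y $ i + axis j 1 $ i" "y $ i = x $ i + axis i 1 $ i"
      by (metis vector_add_component)+
    then show ?thesis by (auto simp: axis_def split: if_splits)
  qed
qed

lemma lattice_edge_axis:
  fixes f :: "(int ^ 'd::finite) set"
  assumes "f \<in> lattice_edges"
  obtains p where "f = axis_edge p"
proof -
  obtain u v where f: "f = {u, v}" and s: "(\<Sum>i\<in>UNIV. \<bar>u $ i - v $ i\<bar>) = 1"
    using assms by (auto simp: lattice_edges_def)
  have "u \<noteq> v" using s by auto
  then obtain i where i: "u $ i \<noteq> v $ i" by (auto simp: vec_eq_iff)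
  have s': "\<bar>u $ i - v $ i\<bar> + (\<Sum>j\<in>UNIV - {i}. \<bar>u $ j - v $ j\<bar>) = 1"
    using s by (simp add: sum.remove[of UNIV i])
  moreover have nn: "0 \<le> (\<Sum>j\<in>UNIV - {i}. \<bar>u $ j - v $ j\<bar>)" by (simp add: sum_nonneg)
  ultimately have 1: "\<bar>u $ i - v $ i\<bar> = 1" and 0: "(\<Sum>j\<in>UNIV - {i}. \<bar>u $ j - v $ j\<bar>) = 0"
    using i by linarith+
  have 2: "u $ j = v $ j" if "j \<noteq> i" for j
    using 0 that by (subst (asm) sum_nonneg_eq_0_iff) auto
  have "v = u + axis i 1 \<or> u = v + axis i 1"
  proof (cases "u $ i < v $ i")
    case True
    then have "v = u + axis i 1" using 1 2 by (auto simp: vec_eq_iff axis_def)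
    then show ?thesis ..
  next
    case False
    then have "u = v + axis i 1" using 1 2 by (auto simp: vec_eq_iff axis_def)
    then show ?thesis ..
  qed
  then have "f = axis_edge (u, i) \<or> f = axis_edge (v, i)" by (auto simp: f axis_edge_def)
  then show ?thesis using that by blast
qed

lemma box_edges_eq_image: "box_edges n = axis_edge ` box_slots n"
proof -
  have "axis_edge (x, i) \<subseteq> lattice_box n \<longleftrightarrow> (x, i) \<in> box_slots n" for x :: "int ^ 'd" and i
  proof
    assume "axis_edge (x, i) \<subseteq> lattice_box n"
    then have "x \<in> lattice_box n" "x + axis i 1 \<in> lattice_box n" by (auto simp: axis_edge_def)
    then show "(x, i) \<in> box_slots n"
      by (auto simp: box_slots_def lattice_box_def dest!: spec[of _ i])
  next
    assume "(x, i) \<in> box_slots n"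
    then have x: "\<And>j. \<bar>x $ j\<bar> \<le> int n" "x $ i < int n" by (auto simp: box_slots_def lattice_box_def)
    have "\<bar>x $ i + 1\<bar> \<le> int n" using x(1)[of i] x(2) by linarith
    then have "\<bar>(x + axis i 1) $ j\<bar> \<le> int n" for j
      using x(1)[of j] by (auto simp: axis_def)
    then show "axis_edge (x, i) \<subseteq> lattice_box n" using x by (auto simp: axis_edge_def lattice_box_def)
  qed
  then show ?thesis
    unfolding box_edges_def using axis_edge_lattice by (auto elim!: lattice_edge_axis)
qed

lemma card_vec_box:
  fixes S :: "'d::finite \<Rightarrow> 'a set"
  shows "card {x :: 'a ^ 'd. \<forall>i. x $ i \<in> S i} = (\<Prod>i\<in>UNIV. card (S i))"
proof -
  have "bij_betw vec_lambda (Pi\<^sub>E UNIV S) {x :: 'a ^ 'd. \<forall>i. x $ i \<in> S i}"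
    by (rule bij_betwI[where g=vec_nth]) (auto simp: PiE_iff)
  then show ?thesis by (simp add: bij_betw_same_card[symmetric] card_PiE)
qed

lemma card_lattice_box: "card (lattice_box n :: (int ^ 'd::finite) set) = (2 * n + 1) ^ CARD('d)"
proof -
  have "(lattice_box n :: (int ^ 'd) set) = {x. \<forall>i. x $ i \<in> {- int n..int n}}"
    by (auto simp: lattice_box_def abs_le_iff minus_le_iff)
  moreover have "nat (2 * int n + 1) = 2 * n + 1" by simp
  ultimately show ?thesis by (simp only: card_vec_box) simp
qed

lemma card_box_slots:
  "card (box_slots n :: ((int ^ 'd::finite) \<times> 'd) set) = CARD('d) * (2 * n * (2 * n + 1) ^ (CARD('d) - 1))"
proof -
  have 1: "card {x :: int ^ 'd. x \<in> lattice_box n \<and> x $ i < int n} = 2 * n * (2 * n + 1) ^ (CARD('d) - 1)" for i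
  proof -
    let ?S = "\<lambda>j. if j = i then {- int n..<int n} else {- int n..int n}"
    have "x \<in> lattice_box n \<and> x $ i < int n \<longleftrightarrow> (\<forall>j. x $ j \<in> ?S j)" for x :: "int ^ 'd"
    proof
      assume x: "x \<in> lattice_box n \<and> x $ i < int n"
      then have "\<bar>x $ j\<bar> \<le> int n" for j by (simp add: lattice_box_def)
      with x show "\<forall>j. x $ j \<in> ?S j" by (simp add: abs_le_iff minus_le_iff)
    next
      assume *: "\<forall>j. x $ j \<in> ?S j"
      have "\<bar>x $ j\<bar> \<le> int n" for j
        using spec[OF *, of j] by (simp add: abs_le_iff minus_le_iff split: if_splits)
      with spec[OF *, of i] show "x \<in> lattice_box n \<and> x $ i < int n" by (simp add: lattice_box_def)
    qed
    then have "card {x :: int ^ 'd. x \<in> lattice_box n \<and> x $ i < int n} = (\<Prod>j\<in>UNIV. card (?S j))"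
      by (simp only: card_vec_box)
    also have "\<dots> = (\<Prod>j\<in>UNIV. if j = i then 2 * n else 2 * n + 1)"
      by (rule prod.cong) (auto simp: nat_eq_iff2)
    also have "\<dots> = 2 * n * (2 * n + 1) ^ (CARD('d) - 1)"
      by (subst prod.remove[of _ i]) (auto simp: card_Diff_singleton intro!: arg_cong2[where f="(*)"] )
    finally show ?thesis .
  qed
  have "box_slots n = (\<lambda>(i, x). (x, i)) ` (SIGMA i:UNIV. {x :: int ^ 'd. x \<in> lattice_box n \<and> x $ i < int n})"
    by (force simp: box_slots_def)
  also have "card \<dots> = card (SIGMA i:UNIV. {x :: int ^ 'd. x \<in> lattice_box n \<and> x $ i < int n})"
    by (rule card_image) (auto simp: inj_on_def)
  also have "\<dots> = (\<Sum>i\<in>(UNIV :: 'd set). card {x :: int ^ 'd. x \<in> lattice_box n \<and> x $ i < int n})"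
    by (rule card_SigmaI) (auto intro: finite_subset[OF _ finite_lattice_box[of n]])
  finally show ?thesis by (simp add: 1)
qed

lemma finite_box_slots: "finite (box_slots n :: ((int ^ 'd::finite) \<times> 'd) set)"
  by (rule finite_subset[of _ "lattice_box n \<times> UNIV"]) (auto simp: box_slots_def finite_lattice_box)

text \<open>The lattice automorphism that takes the edge at the origin in the reference direction \<open>r\<close> to the edge
  at \<open>x\<close> in direction \<open>i\<close>: exchange the coordinates \<open>r\<close> and \<open>i\<close>, then translate by \<open>x\<close>.\<close>

definition move :: "'d \<Rightarrow> (int ^ 'd::finite) \<times> 'd \<Rightarrow> int ^ 'd \<Rightarrow> int ^ 'd" where
  "move r = (\<lambda>(x, i) z. \<chi> j. x $ j + z $ Transposition.transpose r i j)"

lemma bij_move: "bij (move r p)"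
proof -
  obtain x i where p: "p = (x, i)" by fastforce
  let ?\<tau> = "Transposition.transpose r i"
  show ?thesis
  proof (rule o_bij)
    show "(\<lambda>w. \<chi> j. w $ ?\<tau> j - x $ ?\<tau> j) \<circ> move r p = id"
      by (auto simp: fun_eq_iff move_def p vec_eq_iff)
    show "move r p \<circ> (\<lambda>w. \<chi> j. w $ ?\<tau> j - x $ ?\<tau> j) = id"
      by (auto simp: fun_eq_iff move_def p vec_eq_iff)
  qed
qed

lemma move_axis_edge: "move r p ` axis_edge (0, r) = axis_edge p"
proof -
  obtain x i where p: "p = (x, i)" by fastforce
  have "Transposition.transpose r i j = r \<longleftrightarrow> j = i" for j
    by (auto simp: Transposition.transpose_def)
  then have "move r p 0 = x" "move r p (axis r 1) = x + axis i 1"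
    by (auto simp: p move_def vec_eq_iff axis_def)
  then show ?thesis by (simp add: axis_edge_def p)
qed

lemma move_isometry:
  "(\<Sum>j\<in>UNIV. \<bar>move r p u $ j - move r p v $ j\<bar>) = (\<Sum>j\<in>UNIV. \<bar>u $ j - v $ j\<bar>)"
proof -
  obtain x i where p: "p = (x, i)" by fastforce
  show ?thesis
    unfolding move_def p
    by (rule sum.reindex_bij_witness[of _ "Transposition.transpose r i" "Transposition.transpose r i"]) auto
qed

lemma move_lattice_edge_iff: "move r p ` f \<in> lattice_edges \<longleftrightarrow> f \<in> lattice_edges"
proof
  assume "f \<in> lattice_edges"
  then obtain u v where "f = {u, v}" "(\<Sum>i\<in>UNIV. \<bar>u $ i - v $ i\<bar>) = 1"
    by (auto simp: lattice_edges_def)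
  then have "move r p ` f = {move r p u, move r p v}"
    "(\<Sum>j\<in>UNIV. \<bar>move r p u $ j - move r p v $ j\<bar>) = 1"
    by (simp_all add: move_isometry)
  then show "move r p ` f \<in> lattice_edges" unfolding lattice_edges_def by blast
next
  assume "move r p ` f \<in> lattice_edges"
  then obtain u v where uv: "move r p ` f = {u, v}" "(\<Sum>i\<in>UNIV. \<bar>u $ i - v $ i\<bar>) = 1"
    by (auto simp: lattice_edges_def)
  define u' where "u' = inv (move r p) u"
  define v' where "v' = inv (move r p) v"
  have uv': "u = move r p u'" "v = move r p v'"
    by (simp_all add: u'_def v'_def bij_is_surj[OF bij_move] surj_f_inv_f)
  have "move r p ` f = move r p ` {u', v'}" using uv(1) uv' by simp
  then have "f = {u', v'}" by (simp only: inj_image_eq_iff[OF bij_is_inj[OF bij_move]])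
  moreover have "(\<Sum>i\<in>UNIV. \<bar>u' $ i - v' $ i\<bar>) = 1" using uv(2) by (simp add: uv' move_isometry)
  ultimately show "f \<in> lattice_edges" unfolding lattice_edges_def by blast
qed

lemma mem_move_lattice_box: "z \<in> move r (x, i) ` lattice_box k \<longleftrightarrow> (\<forall>j. \<bar>z $ j - x $ j\<bar> \<le> int k)"
proof
  assume "z \<in> move r (x, i) ` lattice_box k"
  then show "\<forall>j. \<bar>z $ j - x $ j\<bar> \<le> int k" by (auto simp: move_def lattice_box_def)
next
  assume *: "\<forall>j. \<bar>z $ j - x $ j\<bar> \<le> int k"
  define w where "w = (\<chi> j. z $ Transposition.transpose r i j - x $ Transposition.transpose r i j)"
  have "z = move r (x, i) w" by (auto simp: w_def move_def vec_eq_iff)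
  moreover have "w \<in> lattice_box k" using * by (auto simp: w_def lattice_box_def)
  ultimately show "z \<in> move r (x, i) ` lattice_box k" by blast
qed

lemma move_box_edges: "(`) (move r p) ` box_edges k = {f \<in> lattice_edges. f \<subseteq> move r p ` lattice_box k}"
proof
  show "(`) (move r p) ` box_edges k \<subseteq> {f \<in> lattice_edges. f \<subseteq> move r p ` lattice_box k}"
    by (auto simp: box_edges_def move_lattice_edge_iff)
  show "{f \<in> lattice_edges. f \<subseteq> move r p ` lattice_box k} \<subseteq> (`) (move r p) ` box_edges k"
  proof clarify
    fix f assume f: "f \<in> lattice_edges" "f \<subseteq> move r p ` lattice_box k"
    define g where "g = inv (move r p) ` f"
    have fg: "f = move r p ` g"
      by (simp add: g_def image_image bij_is_surj[OF bij_move] surj_f_inv_f)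
    have "g \<subseteq> lattice_box k"
      using f(2) unfolding fg by (simp add: inj_image_subset_iff[OF bij_is_inj[OF bij_move]])
    moreover have "g \<in> lattice_edges" using f(1) by (simp add: fg move_lattice_edge_iff)
    ultimately show "f \<in> (`) (move r p) ` box_edges k" using fg by (auto simp: box_edges_def)
  qed
qed

section \<open>Edge probabilities in boxes around the edge\<close>

lemma tree_prob_cong:
  assumes "\<And>f. f \<in> E \<Longrightarrow> w f = w' f"
  shows "tree_prob w V E A = tree_prob w' V E A"
proof -
  have "prod w T = prod w' T" if "T \<in> spanning_trees V E" for T
    using that assms by (intro prod.cong) (auto simp: spanning_trees_def)
  then show ?thesis by (simp add: tree_prob_def)
qed

lemma tree_prob_measurable:
  assumes "E \<subseteq> J" "sets \<mu> = sets borel"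
  shows "(\<lambda>\<omega>. tree_prob (edge_weight \<beta> \<omega>) V E A) \<in> borel_measurable (Pi\<^sub>M J (\<lambda>_. \<mu>))"
proof -
  have "(\<lambda>\<omega>. \<omega> f) \<in> borel_measurable (Pi\<^sub>M J (\<lambda>_. \<mu>))" if "f \<in> E" for f
    using measurable_component_singleton[of f J "\<lambda>_. \<mu>"] that assms
    by (auto cong: measurable_cong_sets)
  then have *: "(\<lambda>\<omega>. prod (edge_weight \<beta> \<omega>) T) \<in> borel_measurable (Pi\<^sub>M J (\<lambda>_. \<mu>))"
    if "T \<in> spanning_trees V E" for T
    using that by (intro borel_measurable_prod borel_measurable_exp[THEN measurable_compose_rev] borel_measurable_times)
      (auto simp: spanning_trees_def)
  show ?thesis
    unfolding tree_prob_def by (intro borel_measurable_divide borel_measurable_sum *) auto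
qed

text \<open>The probability of the edge \<open>p\<close> in the box of radius \<open>k + 1\<close> around it; radius 0 is excluded because
  that box does not contain the edge.\<close>

definition local_prob :: "'d \<Rightarrow> real \<Rightarrow> nat \<Rightarrow> (int ^ 'd::finite) \<times> 'd \<Rightarrow> ((int ^ 'd) set \<Rightarrow> real) \<Rightarrow> real" where
  "local_prob r \<beta> k p \<omega> = tree_prob (edge_weight \<beta> \<omega>) (move r p ` lattice_box (Suc k))
     ((`) (move r p) ` box_edges (Suc k)) {axis_edge p}"

text \<open>In the environment seen from the edge \<open>p\<close>, the local probability is that of the reference edge in a
  centred box.\<close>

lemma local_prob_eq_box_prob:
  "local_prob r \<beta> k p \<omega> = box_prob \<beta> (\<lambda>f. \<omega> (move r p ` f)) (Suc k) {axis_edge (0, r)}"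
  using tree_prob_image[OF bij_move finite_graph_box, of "edge_weight \<beta> \<omega>" r p "Suc k" "{axis_edge (0, r)}"]
  by (simp add: local_prob_def box_prob_def move_axis_edge)

lemma reference_edge_in_box: "axis_edge (0, r) \<in> box_edges (Suc k)"
  by (auto simp: box_edges_eq_image box_slots_def lattice_box_def)

lemma axis_edge_in_moved_box: "axis_edge p \<in> (`) (move r p) ` box_edges (Suc k)"
  using reference_edge_in_box[of r k] move_axis_edge[of r p] by (metis imageI)

lemma moved_box_edges_lattice: "(`) (move r p) ` box_edges k \<subseteq> lattice_edges"
  by (auto simp: move_box_edges)

lemma moved_box:
  "finite_graph (move r p ` lattice_box k) ((`) (move r p) ` box_edges k)"
  "connected_on (move r p ` lattice_box k) ((`) (move r p) ` box_edges k)"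
  by (intro finite_graph_image bij_move finite_graph_box connected_on_image lattice_box_connected)+

lemma edge_prob_le_local_prob: "edge_prob \<beta> \<omega> (axis_edge p) \<le> local_prob r \<beta> k p \<omega>"
  unfolding local_prob_def
  by (intro edge_prob_le_subgraph moved_box moved_box_edges_lattice axis_edge_in_moved_box)

lemma local_prob_bounds: "0 \<le> local_prob r \<beta> k p \<omega>" "local_prob r \<beta> k p \<omega> \<le> 1"
  unfolding local_prob_def by (intro tree_prob_bounds moved_box; simp)+

text \<open>The box of radius \<open>k + m + 1\<close> around \<open>p\<close> contains the centred box of radius \<open>k\<close>, where \<open>m\<close> bounds the
  coordinates of \<open>p\<close>; by monotonicity the local probability lies between the infinite-volume one and the
  one in the centred box.\<close>

lemma local_prob_tendsto: "(\<lambda>k. local_prob r \<beta> k p \<omega>) \<longlonglongrightarrow> edge_prob \<beta> \<omega> (axis_edge p)"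
proof -
  obtain x i where p: "p = (x, i)" by fastforce
  obtain m where m: "x \<in> lattice_box m" using finite_subset_lattice_box[of "{x}"] by auto
  obtain N where N: "{axis_edge p} \<subseteq> box_edges N"
    using finite_subset_box_edges[of "{axis_edge p}"] axis_edge_lattice[of p] by blast
  have "local_prob r \<beta> (k + m) p \<omega> \<le> box_prob \<beta> \<omega> k {axis_edge p}" if k: "k \<ge> N" for k
    unfolding local_prob_def box_prob_def
  proof (rule tree_prob_antimono[OF finite_graph_box lattice_box_connected moved_box])
    have "z \<in> move r p ` lattice_box (Suc (k + m))" if "z \<in> lattice_box k" for z
    proof -
      have "\<bar>z $ j - x $ j\<bar> \<le> int (Suc (k + m))" for j
      proof -
        have "\<bar>z $ j\<bar> \<le> int k" "\<bar>x $ j\<bar> \<le> int m" using that m by (simp_all add: lattice_box_def)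
        then show ?thesis by (simp add: abs_le_iff)
      qed
      then show ?thesis unfolding p mem_move_lattice_box by blast
    qed
    then show "box_edges k \<subseteq> (`) (move r p) ` box_edges (Suc (k + m))"
      unfolding move_box_edges by (auto simp: box_edges_def)
    show "{axis_edge p} \<subseteq> box_edges k" using N box_edges_mono[OF k] by blast
  qed simp
  then have upper: "\<forall>\<^sub>F k in sequentially. local_prob r \<beta> (k + m) p \<omega> \<le> box_prob \<beta> \<omega> k {axis_edge p}"
    by (rule eventually_sequentiallyI)
  have lower: "\<forall>\<^sub>F k in sequentially. edge_prob \<beta> \<omega> (axis_edge p) \<le> local_prob r \<beta> (k + m) p \<omega>"
    by (simp add: edge_prob_le_local_prob)
  have "(\<lambda>k. local_prob r \<beta> (k + m) p \<omega>) \<longlonglongrightarrow> edge_prob \<beta> \<omega> (axis_edge p)"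
    by (rule tendsto_sandwich[OF lower upper tendsto_const edge_prob_limit[OF axis_edge_lattice]])
  then show ?thesis by (rule LIMSEQ_offset)
qed

text \<open>If this fails, then the boxes of radius \<open>k + 1\<close> around \<open>p\<close> and \<open>q\<close> are disjoint.\<close>

definition near :: "nat \<Rightarrow> (int ^ 'd::finite) \<times> 'd \<Rightarrow> (int ^ 'd) \<times> 'd \<Rightarrow> bool" where
  "near k p q \<longleftrightarrow> (\<forall>j. \<bar>fst p $ j - fst q $ j\<bar> \<le> 2 * int (Suc k))"

lemma disjoint_moved_boxes:
  fixes p q :: "(int ^ 'd::finite) \<times> 'd"
  assumes "\<not> near k p q"
  shows "(`) (move r p) ` box_edges (Suc k) \<inter> (`) (move r q) ` box_edges (Suc k) = {}"
proof (rule ccontr)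
  assume "\<not> ?thesis"
  then obtain f where f: "f \<in> lattice_edges" "f \<subseteq> move r p ` lattice_box (Suc k)"
    "f \<subseteq> move r q ` lattice_box (Suc k)"
    by (auto simp: move_box_edges)
  have "f \<noteq> {}" using lattice_edge_card[OF f(1)] by auto
  with f obtain z where z: "z \<in> move r p ` lattice_box (Suc k)" "z \<in> move r q ` lattice_box (Suc k)"
    by blast
  have "\<bar>fst p $ j - fst q $ j\<bar> \<le> 2 * int (Suc k)" for j
  proof -
    have "\<bar>z $ j - fst p $ j\<bar> \<le> int (Suc k)" "\<bar>z $ j - fst q $ j\<bar> \<le> int (Suc k)"
      using z mem_move_lattice_box[of z r "fst p" "snd p"] mem_move_lattice_box[of z r "fst q" "snd q"]
      by auto
    then show ?thesis by (simp add: abs_le_iff)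
  qed
  then show False using assms by (simp add: near_def)
qed

lemma card_near:
  fixes p :: "(int ^ 'd::finite) \<times> 'd"
  shows "card {q \<in> box_slots n. near k p q} \<le> (4 * Suc k + 1) ^ CARD('d) * CARD('d)"
proof -
  let ?B = "{y :: int ^ 'd. \<forall>j. y $ j \<in> {fst p $ j - 2 * int (Suc k)..fst p $ j + 2 * int (Suc k)}}"
  have "card {c - 2 * int (Suc k)..c + 2 * int (Suc k)} = 4 * Suc k + 1" for c by simp
  then have B: "card ?B = (4 * Suc k + 1) ^ CARD('d)"
    unfolding card_vec_box by (simp only: prod_constant)
  have sub: "{q \<in> box_slots n. near k p q} \<subseteq> ?B \<times> UNIV"
  proof
    fix q assume "q \<in> {q \<in> box_slots n. near k p q}"
    then have "\<bar>fst p $ j - fst q $ j\<bar> \<le> 2 * int (Suc k)" for j by (simp add: near_def)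
    then have "fst q \<in> ?B" by (smt (verit) atLeastAtMost_iff mem_Collect_eq)
    then show "q \<in> ?B \<times> UNIV" by (cases q) simp
  qed
  have "0 < card ?B" unfolding B by simp
  then have "finite (?B \<times> (UNIV :: 'd set))" by (intro finite_cartesian_product card_ge_0_finite) auto
  from card_mono[OF this sub] show ?thesis unfolding card_cartesian_product B .
qed

text \<open>The direction \<open>r\<close> of the reference edge is arbitrary; it is a parameter in order to fix the dimension.\<close>

locale random_environment =
  fixes \<mu> :: "real measure" and \<beta> :: real and r :: "'d::finite"
  assumes prob_mu: "prob_space \<mu>" and sets_mu: "sets \<mu> = sets borel"
begin

abbreviation \<P> :: "((int ^ 'd) set \<Rightarrow> real) measure" where
  "\<P> \<equiv> environment \<mu>"

sublocale prob_space \<P>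
  unfolding environment_def by (intro prob_space_PiM prob_mu)

lemma local_prob_measurable [measurable]: "local_prob r \<beta> k p \<in> borel_measurable \<P>"
  unfolding local_prob_def environment_def
  using moved_box_edges_lattice sets_mu by (rule tree_prob_measurable)

lemma edge_prob_measurable:
  assumes "e \<in> (lattice_edges :: (int ^ 'd) set set)"
  shows "(\<lambda>\<omega>. edge_prob \<beta> \<omega> e) \<in> borel_measurable \<P>"
proof -
  obtain p where p: "e = axis_edge p" using assms by (rule lattice_edge_axis)
  show ?thesis unfolding p
    by (rule borel_measurable_LIMSEQ_real[OF local_prob_tendsto]) measurable
qed

lemma environment_reindex:
  assumes "inj_on \<phi> lattice_edges" "\<phi> \<in> lattice_edges \<rightarrow> lattice_edges"
  shows "distr \<P> \<P> (\<lambda>\<omega>. \<lambda>f\<in>lattice_edges. \<omega> (\<phi> f)) = \<P>"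
  unfolding environment_def using distr_PiM_reindex[of lattice_edges "\<lambda>_. \<mu>", OF _ assms] prob_mu by simp

text \<open>The automorphism \<open>move r p\<close> permutes the lattice edges, and permuting i.i.d. weights does not change
  their law.\<close>

lemma local_prob_law:
  assumes [measurable]: "h \<in> borel_measurable borel"
  shows "expectation (\<lambda>\<omega>. h (local_prob r \<beta> k p \<omega>)) =
    expectation (\<lambda>\<omega>. h (box_prob \<beta> \<omega> (Suc k) {axis_edge (0, r)}) :: real)"
proof -
  let ?\<phi> = "\<lambda>\<omega>. \<lambda>f\<in>lattice_edges. \<omega> (move r p ` f) :: real"
  let ?G = "\<lambda>\<omega>. box_prob \<beta> \<omega> (Suc k) {axis_edge (0, r)}"
  have "box_edges (Suc k) \<subseteq> (lattice_edges :: (int ^ 'd) set set)" by (auto simp: box_edges_def)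
  then have [measurable]: "?G \<in> borel_measurable \<P>"
    unfolding box_prob_def environment_def using sets_mu by (rule tree_prob_measurable)
  have \<phi> [measurable]: "?\<phi> \<in> \<P> \<rightarrow>\<^sub>M \<P>"
    unfolding environment_def
    by (intro measurable_restrict measurable_component_singleton) (simp add: move_lattice_edge_iff)
  have "local_prob r \<beta> k p \<omega> = ?G (?\<phi> \<omega>)" for \<omega>
    unfolding local_prob_eq_box_prob box_prob_def
    by (intro tree_prob_cong) (auto simp: box_edges_def)
  then have "expectation (\<lambda>\<omega>. h (local_prob r \<beta> k p \<omega>)) = expectation (\<lambda>\<omega>. h (?G (?\<phi> \<omega>)))" by simp
  also have "\<dots> = (\<integral>\<omega>. h (?G \<omega>) \<partial>distr \<P> \<P> ?\<phi>)"
    by (rule integral_distr[symmetric]) measurable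
  also have "distr \<P> \<P> ?\<phi> = \<P>"
    by (rule environment_reindex)
      (auto simp: inj_on_def inj_image_eq_iff[OF bij_is_inj[OF bij_move]] move_lattice_edge_iff)
  finally show ?thesis .
qed

lemma coordinates_indep: "indep_vars (\<lambda>_. \<mu>) (\<lambda>f \<omega>. \<omega> f) (lattice_edges :: (int ^ 'd) set set)"
proof (subst indep_vars_iff_distr_eq_PiM')
  show "(lattice_edges :: (int ^ 'd) set set) \<noteq> {}" using axis_edge_lattice by blast
  have "distr \<P> \<P> (\<lambda>x. restrict x lattice_edges) = distr \<P> \<P> (\<lambda>x. x)"
    by (intro distr_cong refl) (auto simp: environment_def space_PiM)
  moreover have "Pi\<^sub>M lattice_edges (\<lambda>f. distr \<P> \<mu> (\<lambda>\<omega>. \<omega> f)) = \<P>"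
    unfolding environment_def by (intro PiM_cong refl distr_PiM_component prob_mu)
  ultimately show "distr \<P> (Pi\<^sub>M lattice_edges (\<lambda>_. \<mu>)) (\<lambda>x. \<lambda>f\<in>lattice_edges. x f) =
      Pi\<^sub>M lattice_edges (\<lambda>f. distr \<P> \<mu> (\<lambda>\<omega>. \<omega> f))"
    by (simp add: environment_def)
qed (simp add: environment_def)

lemma local_prob_uncorrelated:
  assumes h: "h \<in> borel_measurable borel" "\<And>x. 0 \<le> x \<Longrightarrow> x \<le> 1 \<Longrightarrow> \<bar>h x\<bar> \<le> 1"
    and "\<not> near k p q"
  shows "expectation (\<lambda>\<omega>. h (local_prob r \<beta> k p \<omega>) * h (local_prob r \<beta> k q \<omega>) :: real) =
    expectation (\<lambda>\<omega>. h (local_prob r \<beta> k p \<omega>)) * expectation (\<lambda>\<omega>. h (local_prob r \<beta> k q \<omega>))"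
proof -
  let ?S = "\<lambda>p. (`) (move r p) ` box_edges (Suc k)"
  note [measurable] = h(1)
  have meas: "(\<lambda>\<omega>. h (local_prob r \<beta> k p \<omega>)) \<in> borel_measurable (Pi\<^sub>M (?S p) (\<lambda>_. \<mu>))" for p
    using measurable_compose[OF tree_prob_measurable[OF order_refl sets_mu] h(1)]
    by (simp add: local_prob_def)
  have restr: "h (local_prob r \<beta> k p (restrict \<omega> (?S p))) = h (local_prob r \<beta> k p \<omega>)" for p \<omega>
    unfolding local_prob_def by (intro arg_cong[where f=h] tree_prob_cong) auto
  have "\<bar>h (local_prob r \<beta> k p \<omega>)\<bar> \<le> 1" for p \<omega> by (intro h(2) local_prob_bounds)
  then have int: "integrable \<P> (\<lambda>\<omega>. h (local_prob r \<beta> k p \<omega>))" for p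
    by (intro integrable_const_bound[of _ 1]) auto
  have "indep_var (Pi\<^sub>M (?S p) (\<lambda>_. \<mu>)) (\<lambda>\<omega>. restrict \<omega> (?S p)) (Pi\<^sub>M (?S q) (\<lambda>_. \<mu>)) (\<lambda>\<omega>. restrict \<omega> (?S q))"
    using indep_var_restrict[OF coordinates_indep disjoint_moved_boxes[OF assms(3)]
        moved_box_edges_lattice moved_box_edges_lattice] by simp
  from indep_var_compose[OF this meas meas]
  have "indep_var borel (\<lambda>\<omega>. h (local_prob r \<beta> k p \<omega>)) borel (\<lambda>\<omega>. h (local_prob r \<beta> k q \<omega>))"
    by (simp add: comp_def restr)
  then show ?thesis using int int by (rule indep_var_lebesgue_integral)
qed

definition spanning_tree_size :: "nat \<Rightarrow> real" where
  "spanning_tree_size n = real (card (lattice_box n :: (int ^ 'd) set)) - 1"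

lemma spanning_tree_size_eq: "spanning_tree_size n = (2 * real n + 1) ^ CARD('d) - 1"
  by (simp add: spanning_tree_size_def card_lattice_box add.commute)

lemma card_box_slots_le: "real (card (box_slots n :: ((int ^ 'd) \<times> 'd) set)) \<le> real CARD('d) * spanning_tree_size n"
proof -
  have "(2 * real n + 1) ^ CARD('d) = (2 * real n + 1) * (2 * real n + 1) ^ (CARD('d) - 1)"
    by (simp flip: power_Suc)
  moreover have "1 \<le> (2 * real n + 1) ^ (CARD('d) - 1)" by simp
  ultimately have "2 * real n * (2 * real n + 1) ^ (CARD('d) - 1) \<le> spanning_tree_size n"
    by (simp add: spanning_tree_size_eq algebra_simps)
  then have "real CARD('d) * (2 * real n * (2 * real n + 1) ^ (CARD('d) - 1)) \<le> real CARD('d) * spanning_tree_size n"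
    by (intro mult_left_mono) auto
  then show ?thesis by (simp add: card_box_slots add.commute)
qed

lemma spanning_tree_size_ge_square:
  assumes "CARD('d) \<ge> 2"
  shows "real n ^ 2 \<le> spanning_tree_size n"
proof -
  have "(2 * real n + 1) ^ 2 \<le> (2 * real n + 1) ^ CARD('d)"
    using assms by (intro power_increasing) auto
  moreover have "real n ^ 2 \<le> (2 * real n + 1) ^ 2 - 1" by (simp add: power2_eq_square algebra_simps)
  ultimately show ?thesis by (simp add: spanning_tree_size_eq)
qed

text \<open>All but a boundary layer of the vertices of the box are lower ends of \<open>d\<close> edges of the box.\<close>

lemma slots_density: "(\<lambda>n. real (card (box_slots n :: ((int ^ 'd) \<times> 'd) set)) / spanning_tree_size n) \<longlonglongrightarrow> real CARD('d)"
proof -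
  define D where "D = CARD('d)"
  have D: "0 < D" by (simp add: D_def)
  have "(\<lambda>n. real D * (2 * real n / (2 * real n + 1)) / (1 - 1 / (2 * real n + 1) ^ D)) \<longlonglongrightarrow> real D * 1 / (1 - 0)"
  proof (intro tendsto_intros)
    show "(\<lambda>n. 2 * real n / (2 * real n + 1)) \<longlonglongrightarrow> 1" by real_asymp
    show "(\<lambda>n. 1 / (2 * real n + 1) ^ D) \<longlonglongrightarrow> 0" using D by real_asymp
  qed simp
  moreover have "real D * (2 * real n / (2 * real n + 1)) / (1 - 1 / (2 * real n + 1) ^ D) =
      real (card (box_slots n :: ((int ^ 'd) \<times> 'd) set)) / spanning_tree_size n" for n
  proof -
    define t where "t = 2 * real n + 1"
    have t: "t > 0" "2 * real n = t - 1" by (simp_all add: t_def)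
    have D': "t ^ D = t * t ^ (D - 1)" using D by (simp flip: power_Suc)
    have "real D * ((t - 1) / t) / (1 - 1 / t ^ D) = (real D * ((t - 1) / t) * t ^ D) / ((1 - 1 / t ^ D) * t ^ D)"
      using t by simp
    also have "\<dots> = real D * ((t - 1) * t ^ (D - 1)) / (t ^ D - 1)"
    proof -
      have "(1 - 1 / t ^ D) * t ^ D = t ^ D - 1" using t by (simp add: left_diff_distrib)
      moreover have "real D * ((t - 1) / t) * t ^ D = real D * ((t - 1) * t ^ (D - 1))"
        using t(1) by (simp add: D')
      ultimately show ?thesis by simp
    qed
    finally show ?thesis
      by (simp add: card_box_slots spanning_tree_size_eq t_def D_def add.commute)
  qed
  ultimately show ?thesis by (simp add: D_def)
qed

lemma inner_box_ratio: "(\<lambda>n. real (card (lattice_box n :: (int ^ 'd) set)) / spanning_tree_size (Suc n)) \<longlonglongrightarrow> 1"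
proof -
  define D where "D = CARD('d)"
  have D: "0 < D" by (simp add: D_def)
  have "(\<lambda>n. ((2 * real n + 1) / (2 * real n + 3)) ^ D / (1 - 1 / (2 * real n + 3) ^ D)) \<longlonglongrightarrow> 1 ^ D / (1 - 0)"
  proof (intro tendsto_intros)
    show "(\<lambda>n. (2 * real n + 1) / (2 * real n + 3)) \<longlonglongrightarrow> 1" by real_asymp
    show "(\<lambda>n. 1 / (2 * real n + 3) ^ D) \<longlonglongrightarrow> 0" using D by real_asymp
  qed simp
  moreover have "((2 * real n + 1) / (2 * real n + 3)) ^ D / (1 - 1 / (2 * real n + 3) ^ D) =
      real (card (lattice_box n :: (int ^ 'd) set)) / spanning_tree_size (Suc n)" for n
  proof -
    have "(2 * real n + 3) ^ D > 0" by simp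
    then have "((2 * real n + 1) / (2 * real n + 3)) ^ D / (1 - 1 / (2 * real n + 3) ^ D) =
        (2 * real n + 1) ^ D / ((2 * real n + 3) ^ D - 1)"
      by (simp add: power_divide right_diff_distrib)
    then show ?thesis by (simp add: card_lattice_box spanning_tree_size_eq D_def add.commute)
  qed
  ultimately show ?thesis by simp
qed

lemma local_average:
  assumes d: "CARD('d) \<ge> 2"
    and h: "h \<in> borel_measurable borel" "\<And>x :: real. 0 \<le> x \<Longrightarrow> x \<le> 1 \<Longrightarrow> 0 \<le> h x \<and> h x \<le> 1"
  shows "AE \<omega> in \<P>. (\<lambda>n. (\<Sum>p\<in>box_slots n. h (local_prob r \<beta> k p \<omega>)) / spanning_tree_size n)
    \<longlonglongrightarrow> real CARD('d) * expectation (\<lambda>\<omega>. h (box_prob \<beta> \<omega> (Suc k) {axis_edge (0, r)}))"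
proof -
  let ?m = "expectation (\<lambda>\<omega>. h (box_prob \<beta> \<omega> (Suc k) {axis_edge (0, r)}))"
  note [measurable] = h(1)
  have "AE \<omega> in \<P>. (\<lambda>n. ((\<Sum>p\<in>box_slots n. h (local_prob r \<beta> k p \<omega>)) -
      real (card (box_slots n :: ((int ^ 'd) \<times> 'd) set)) * ?m) / spanning_tree_size n) \<longlonglongrightarrow> 0"
  proof (rule strong_law_local_dependence[where near="near k" and K="CARD('d)"
        and C="(4 * Suc k + 1) ^ CARD('d) * CARD('d)"])
    show "expectation (\<lambda>\<omega>. h (local_prob r \<beta> k p \<omega>)) = ?m" for p
      by (rule local_prob_law) measurable
    show "expectation (\<lambda>\<omega>. h (local_prob r \<beta> k p \<omega>) * h (local_prob r \<beta> k q \<omega>)) = ?m * ?m"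
      if "\<not> near k p q" for p q
    proof -
      have "\<bar>h x\<bar> \<le> 1" if "0 \<le> x" "x \<le> 1" for x using h(2)[OF that] by simp
      then show ?thesis by (subst local_prob_uncorrelated[OF h(1) _ that]) (simp_all add: local_prob_law[OF h(1)])
    qed
    show "0 \<le> h (local_prob r \<beta> k p \<omega>)" "h (local_prob r \<beta> k p \<omega>) \<le> 1" for p \<omega>
      using h(2)[OF local_prob_bounds] by blast+
    show "(\<lambda>\<omega>. h (local_prob r \<beta> k p \<omega>)) \<in> borel_measurable \<P>" for p by measurable
  qed (rule finite_box_slots card_near card_box_slots_le spanning_tree_size_ge_square[OF d])+
  then show ?thesis
  proof eventually_elim
    case (elim \<omega>)
    from tendsto_add[OF elim tendsto_mult[OF slots_density tendsto_const[of ?m]]] show ?case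
      by (simp add: diff_divide_distrib)
  qed
qed

text \<open>The left-hand side is the same for all edges by \<open>local_prob_law\<close>.  In particular, the moments of the infinite-volume edge
  probability do not depend on \<open>e\<close>.\<close>

lemma expectation_limit:
  assumes e: "e \<in> (lattice_edges :: (int ^ 'd) set set)"
  shows "(\<lambda>k. expectation (\<lambda>\<omega>. box_prob \<beta> \<omega> (Suc k) {axis_edge (0, r)} ^ j)) \<longlonglongrightarrow>
    expectation (\<lambda>\<omega>. edge_prob \<beta> \<omega> e ^ j)"
proof -
  obtain p where p: "e = axis_edge p" using e by (rule lattice_edge_axis)
  have "(\<lambda>k. expectation (\<lambda>\<omega>. local_prob r \<beta> k p \<omega> ^ j)) \<longlonglongrightarrow> expectation (\<lambda>\<omega>. edge_prob \<beta> \<omega> e ^ j)"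
  proof (rule integral_dominated_convergence[where w="\<lambda>_. 1"])
    show "(\<lambda>\<omega>. edge_prob \<beta> \<omega> e ^ j) \<in> borel_measurable \<P>"
      using edge_prob_measurable[OF e] by (rule borel_measurable_power)
    show "AE \<omega> in \<P>. (\<lambda>k. local_prob r \<beta> k p \<omega> ^ j) \<longlonglongrightarrow> edge_prob \<beta> \<omega> e ^ j"
      unfolding p by (intro AE_I2 tendsto_power local_prob_tendsto)
    show "AE \<omega> in \<P>. norm (local_prob r \<beta> k p \<omega> ^ j) \<le> 1" for k
    proof (rule AE_I2)
      fix \<omega> :: "(int ^ 'd) set \<Rightarrow> real"
      have "0 \<le> local_prob r \<beta> k p \<omega> ^ j" "local_prob r \<beta> k p \<omega> ^ j \<le> 1"
        by (intro zero_le_power power_le_one local_prob_bounds)+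
      then show "norm (local_prob r \<beta> k p \<omega> ^ j) \<le> 1" by simp
    qed
  qed simp_all
  moreover have "expectation (\<lambda>\<omega>. local_prob r \<beta> k p \<omega> ^ j) =
      expectation (\<lambda>\<omega>. box_prob \<beta> \<omega> (Suc k) {axis_edge (0, r)} ^ j)" for k
    by (rule local_prob_law) measurable
  ultimately show ?thesis by simp
qed

text \<open>Integrate \<open>sum_edge_prob_le\<close>, divide by the number of tree edges and let the box grow.  The mean
  degree of a vertex in the limiting subgraph, which is twice this quantity, is thus at most 2.\<close>

lemma mean_degree_bound:
  assumes "CARD('d) \<ge> 2"
  shows "real CARD('d) * expectation (\<lambda>\<omega>. edge_prob \<beta> \<omega> (axis_edge (0, r))) \<le> 1"
proof (rule LIMSEQ_le_const2)
  let ?q = "expectation (\<lambda>\<omega>. edge_prob \<beta> \<omega> (axis_edge (0, r)))"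
  show "(\<lambda>n. real (card (box_slots n :: ((int ^ 'd) \<times> 'd) set)) / spanning_tree_size n * ?q) \<longlonglongrightarrow> real CARD('d) * ?q"
    by (intro tendsto_mult slots_density tendsto_const)
  have same: "expectation (\<lambda>\<omega>. edge_prob \<beta> \<omega> e) = ?q" if "e \<in> lattice_edges" for e
    using LIMSEQ_unique[OF expectation_limit[OF that, of 1] expectation_limit[OF axis_edge_lattice, of 1]] by simp
  have int: "integrable \<P> (\<lambda>\<omega>. edge_prob \<beta> \<omega> e)" if "e \<in> lattice_edges" for e
    using edge_prob_bounds[OF that] edge_prob_measurable[OF that]
    by (intro integrable_const_bound[of _ 1]) auto
  have "real (card (box_slots n :: ((int ^ 'd) \<times> 'd) set)) / spanning_tree_size n * ?q \<le> 1" if "n \<ge> 1" for n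
  proof -
    have pos: "spanning_tree_size n > 0" using spanning_tree_size_ge_square[OF assms, of n] that
      by (meson less_le_trans of_nat_0_less_iff zero_less_power less_le_trans zero_less_one)
    have le: "(\<Sum>p\<in>box_slots n. edge_prob \<beta> \<omega> (axis_edge p)) \<le> spanning_tree_size n" for \<omega> :: "(int ^ 'd) set \<Rightarrow> real"
      using sum_edge_prob_le[of \<beta> \<omega> n]
      by (simp add: box_edges_eq_image sum.reindex[OF inj_on_subset[OF inj_axis_edge]] spanning_tree_size_def)
    have "real (card (box_slots n :: ((int ^ 'd) \<times> 'd) set)) * ?q =
        (\<Sum>p\<in>(box_slots n :: ((int ^ 'd) \<times> 'd) set). ?q)"
      by simp
    also have "\<dots> = (\<Sum>p\<in>box_slots n. expectation (\<lambda>\<omega>. edge_prob \<beta> \<omega> (axis_edge p)))"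
      by (intro sum.cong refl same[symmetric] axis_edge_lattice)
    also have "\<dots> = expectation (\<lambda>\<omega>. \<Sum>p\<in>box_slots n. edge_prob \<beta> \<omega> (axis_edge p))"
      by (simp add: int axis_edge_lattice)
    also have "\<dots> \<le> spanning_tree_size n"
      by (intro integral_le_const Bochner_Integration.integrable_sum int axis_edge_lattice AE_I2 le)
    finally show ?thesis using pos by (simp add: divide_simps)
  qed
  then show "\<exists>N. \<forall>n\<ge>N. real (card (box_slots n :: ((int ^ 'd) \<times> 'd) set)) / spanning_tree_size n * ?q \<le> 1" by blast
qed

end

section \<open>The limit of the overlap\<close>

text \<open>A sandwich in which the two bounds become sharp only when an auxiliary scale \<open>k\<close> is sent to infinity
  after \<open>n\<close>.\<close>

lemma tendsto_between_scales:
  fixes X :: "nat \<Rightarrow> real" and L U :: "nat \<Rightarrow> nat \<Rightarrow> real"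
  assumes "\<And>k n. n \<ge> N \<Longrightarrow> L k n \<le> X n" "\<And>k n. n \<ge> N \<Longrightarrow> X n \<le> U k n"
    and "\<And>k. L k \<longlonglongrightarrow> l k" "\<And>k. U k \<longlonglongrightarrow> u k"
    and "l \<longlonglongrightarrow> l'" "u \<longlonglongrightarrow> c" "c \<le> l'"
  shows "X \<longlonglongrightarrow> c"
proof (rule order_tendstoI)
  fix y assume "y < c"
  then have "y < l'" using assms(7) by simp
  then have "\<forall>\<^sub>F k in sequentially. y < l k" by (rule order_tendstoD(1)[OF assms(5)])
  then obtain k where "y < l k" by (meson eventually_happens sequentially_bot)
  then have "\<forall>\<^sub>F n in sequentially. y < L k n" using assms(3) by (intro order_tendstoD(1))
  with eventually_ge_at_top[of N] show "\<forall>\<^sub>F n in sequentially. y < X n"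
    by eventually_elim (use assms(1) less_le_trans in blast)
next
  fix y assume "c < y"
  then have "\<forall>\<^sub>F k in sequentially. u k < y" using assms(6) by (intro order_tendstoD(2)) auto
  then obtain k where "u k < y" by (meson eventually_happens sequentially_bot)
  then have "\<forall>\<^sub>F n in sequentially. U k n < y" using assms(4) by (intro order_tendstoD(2))
  with eventually_ge_at_top[of N] show "\<forall>\<^sub>F n in sequentially. X n < y"
    by eventually_elim (use assms(2) le_less_trans in blast)
qed

theorem lemma3p4p6:
  fixes \<mu> :: "real measure" and \<beta> :: real
  assumes "CARD('d::finite) \<ge> 2"
    and "\<beta> \<ge> 0"
    and "prob_space \<mu>" and "sets \<mu> = sets borel"
    and "\<And>x. measure \<mu> {x} = 0"
  shows "\<exists>\<rho>::real.
    (AE \<omega> in (environment \<mu> :: ((int ^ 'd) set \<Rightarrow> real) measure).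
       (\<lambda>n. expected_overlap \<beta> \<omega> n / (real (card (lattice_box n :: (int ^ 'd) set)) - 1)) \<longlonglongrightarrow> \<rho>) \<and>
    (\<forall>e \<in> (lattice_edges :: (int ^ 'd) set set).
       \<rho> = real CARD('d) *
         (\<integral>\<omega>. (edge_prob \<beta> \<omega> e)\<^sup>2 \<partial>(environment \<mu> :: ((int ^ 'd) set \<Rightarrow> real) measure)))"
proof -
  fix r :: 'd
  interpret random_environment \<mu> \<beta> r by (rule random_environment.intro) fact+
  let ?d = "real CARD('d)"
  let ?c = "\<lambda>j k. expectation (\<lambda>\<omega>. box_prob \<beta> \<omega> (Suc k) {axis_edge (0, r)} ^ j)"
  define q where "q = expectation (\<lambda>\<omega>. edge_prob \<beta> \<omega> (axis_edge (0, r)))"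
  define \<rho> where "\<rho> = ?d * expectation (\<lambda>\<omega>. (edge_prob \<beta> \<omega> (axis_edge (0, r)))\<^sup>2)"
  have c1: "?c 1 \<longlonglongrightarrow> q" using expectation_limit[OF axis_edge_lattice, of 1] by (simp add: q_def)
  have c2: "(\<lambda>k. ?d * ?c 2 k) \<longlonglongrightarrow> \<rho>"
    unfolding \<rho>_def by (intro tendsto_mult tendsto_const expectation_limit axis_edge_lattice)
  have "AE \<omega> in \<P>. \<forall>k. (\<lambda>n. (\<Sum>p\<in>box_slots n. local_prob r \<beta> k p \<omega> ^ 1) / spanning_tree_size n) \<longlonglongrightarrow> ?d * ?c 1 k"
    unfolding AE_all_countable by (intro allI local_average assms(1)) (auto simp: power_le_one)
  moreover have "AE \<omega> in \<P>. \<forall>k. (\<lambda>n. (\<Sum>p\<in>box_slots n. local_prob r \<beta> k p \<omega> ^ 2) / spanning_tree_size n) \<longlonglongrightarrow> ?d * ?c 2 k"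
    unfolding AE_all_countable by (intro allI local_average assms(1)) (auto simp: power_le_one)
  ultimately have "AE \<omega> in \<P>. (\<lambda>n. expected_overlap \<beta> \<omega> n / spanning_tree_size n) \<longlonglongrightarrow> \<rho>"
  proof eventually_elim
    case (elim \<omega>)
    let ?f = "\<lambda>k p. local_prob r \<beta> k p \<omega>"
    let ?p = "\<lambda>p. edge_prob \<beta> \<omega> (axis_edge p)"
    \<comment> \<open>The edges counted in the box of radius \<open>n\<close> suffice to touch the vertices in radius \<open>n - 1\<close>.\<close>
    let ?b = "\<lambda>n. real (card (lattice_box (n - 1) :: (int ^ 'd) set)) / spanning_tree_size n"
    have S: "(\<Sum>e\<in>box_edges n. edge_prob \<beta> \<omega> e) = (\<Sum>p\<in>box_slots n. ?p p)"
      and X: "expected_overlap \<beta> \<omega> n = (\<Sum>p\<in>box_slots n. (?p p)\<^sup>2)" for n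
      by (simp_all add: expected_overlap_def box_edges_eq_image sum.reindex[OF inj_on_subset[OF inj_axis_edge]])
    have a: "spanning_tree_size n \<ge> 0" for n
      using spanning_tree_size_ge_square[OF assms(1), of n] by (meson order_trans zero_le_power2)
    have bounds: "0 \<le> ?p p" "?p p \<le> ?f k p" "?f k p \<le> 1" for k p
      by (rule edge_prob_bounds axis_edge_lattice edge_prob_le_local_prob local_prob_bounds)+
    show ?case
    proof (rule tendsto_between_scales[where N=1 and l'="\<rho> - 2 * (?d * q - 1)"
          and u="\<lambda>k. ?d * ?c 2 k" and l="\<lambda>k. ?d * ?c 2 k - 2 * (?d * ?c 1 k - 1)"
          and U="\<lambda>k n. (\<Sum>p\<in>box_slots n. ?f k p ^ 2) / spanning_tree_size n"
          and L="\<lambda>k n. (\<Sum>p\<in>box_slots n. ?f k p ^ 2) / spanning_tree_size n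
            - 2 * ((\<Sum>p\<in>box_slots n. ?f k p ^ 1) / spanning_tree_size n - ?b n)"])
      show "expected_overlap \<beta> \<omega> n / spanning_tree_size n \<le> (\<Sum>p\<in>box_slots n. ?f k p ^ 2) / spanning_tree_size n" for k n
        unfolding X using a bounds by (intro divide_right_mono sum_mono power_mono)
      show "(\<Sum>p\<in>box_slots n. ?f k p ^ 2) / spanning_tree_size n
            - 2 * ((\<Sum>p\<in>box_slots n. ?f k p ^ 1) / spanning_tree_size n - ?b n)
          \<le> expected_overlap \<beta> \<omega> n / spanning_tree_size n" if "n \<ge> 1" for k n
      proof -
        have "(?f k p)\<^sup>2 - 2 * (?f k p - ?p p) \<le> (?p p)\<^sup>2" for p
        proof -
          have "(?f k p)\<^sup>2 - (?p p)\<^sup>2 = (?f k p + ?p p) * (?f k p - ?p p)"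
            by (simp add: power2_eq_square algebra_simps)
          also have "\<dots> \<le> 2 * (?f k p - ?p p)"
          proof (rule mult_right_mono)
            have "?p p \<le> ?f k p" "?f k p \<le> 1" by (rule bounds)+
            then show "?f k p + ?p p \<le> 2" "0 \<le> ?f k p - ?p p" by linarith+
          qed
          finally show ?thesis by simp
        qed
        then have "(\<Sum>p\<in>box_slots n. (?f k p)\<^sup>2 - 2 * (?f k p - ?p p)) \<le> expected_overlap \<beta> \<omega> n"
          unfolding X by (rule sum_mono)
        moreover have "real (card (lattice_box (n - 1) :: (int ^ 'd) set)) \<le> (\<Sum>p\<in>box_slots n. ?p p)"
          using sum_edge_prob_ge[where n="n - 1" and \<beta>=\<beta> and \<omega>=\<omega>] that by (simp add: S)
        ultimately have "(\<Sum>p\<in>box_slots n. ?f k p ^ 2) - 2 * ((\<Sum>p\<in>box_slots n. ?f k p ^ 1) -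
            real (card (lattice_box (n - 1) :: (int ^ 'd) set))) \<le> expected_overlap \<beta> \<omega> n"
          by (simp add: sum_subtractf sum_distrib_left[symmetric] right_diff_distrib)
        from divide_right_mono[OF this a[of n]] show ?thesis
          by (simp add: diff_divide_distrib right_diff_distrib)
      qed
      have b: "?b \<longlonglongrightarrow> 1" by (rule LIMSEQ_imp_Suc) (simp add: inner_box_ratio)
      show "(\<lambda>n. (\<Sum>p\<in>box_slots n. ?f k p ^ 2) / spanning_tree_size n
            - 2 * ((\<Sum>p\<in>box_slots n. ?f k p ^ 1) / spanning_tree_size n - ?b n))
          \<longlonglongrightarrow> ?d * ?c 2 k - 2 * (?d * ?c 1 k - 1)" for k
        using elim by (intro tendsto_intros b) auto
      show "(\<lambda>k. ?d * ?c 2 k - 2 * (?d * ?c 1 k - 1)) \<longlonglongrightarrow> \<rho> - 2 * (?d * q - 1)"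
        by (intro tendsto_intros c2 c1)
      show "\<rho> \<le> \<rho> - 2 * (?d * q - 1)" using mean_degree_bound[OF assms(1)] by (simp add: q_def)
    qed (use elim c2 in auto)
  qed
  moreover have "\<rho> = ?d * expectation (\<lambda>\<omega>. (edge_prob \<beta> \<omega> e)\<^sup>2)" if "e \<in> lattice_edges" for e
    unfolding \<rho>_def using LIMSEQ_unique[OF expectation_limit[OF axis_edge_lattice] expectation_limit[OF that]] by simp
  ultimately show ?thesis unfolding spanning_tree_size_def by (intro exI[of _ \<rho>]) blast
qed

end
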